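(* Let $(\mathbb M,\theta,g)$ be a $(2n+1)$-dimensional contact Riemannian manifold with $(\mathbb M,g)$ complete. For every $f\in C^\infty(\mathbb M)$ and every local orthonormal frame $X_1,\dots,X_{2n}$ of $\mathcal H(\mathbb M)$ with structure coefficients $[X_i,X_j]=\sum_k w_{ij}^kX_k+\gamma_{ij}Z$, $[X_i,Z]=\sum_j\delta_i^jX_j$ and $\delta_i^i=0$ for all $i$, the following horizontal Bochner formula holds on the domain of the frame: $$\Gamma_2(f)=\|\nabla_{\mathcal H}^2f\|^2+\mathcal R(f,f)-2\sum_{i,j=1}^{2n}\gamma_{ij}(X_jZf)(X_if).$$
   Context: Contact Riemannian manifold: $\mathbb M$ is a smooth $(2n+1)$-dimensional manifold with contact form $\theta$, Reeb field $Z$ ($\theta(Z)=1$, $\mathcal L_Z\theta=0$), a Riemannian metric $g=\langle\cdot,\cdot\rangle$ and a $(1,1)$-tensor $J$ with $g(X,Z)=\theta(X)$, $J^2=-I+\theta\otimes Z$, $g(X,JY)=d\theta(X,Y)$, where $d\theta(X,Y)=X\theta(Y)-Y\theta(X)-\theta([X,Y])$. $\mathcal H(\mathbb M)=\ker\theta$; $\nabla_{\mathcal H}f$ is the orthogonal projection of the Riemannian gradient on $\mathcal H(\mathbb M)$. The sub-Laplacian $L$ is determined by $\int (Lf)h\,d\mu=-\int\langle\nabla_{\mathcal H}f,\nabla_{\mathcal H}h\rangle d\mu$, where $\mu$ is the measure given by $\theta\wedge(d\theta)^n$; equivalently $L=\Delta_g-Z^2$. $\Gamma(f,h)=\frac12(L(fh)-fLh-hLf)=\langle\nabla_{\mathcal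 H}f,\nabla_{\mathcal H}h\rangle$ and $\Gamma_2(f)=\frac12\big(L\Gamma(f,f)-2\Gamma(f,Lf)\big)$. Tanno's connection $\nabla$ is the unique linear connection with $\nabla\theta=0$, $\nabla Z=0$, $\nabla g=0$, torsion $T(X,Y)=d\theta(X,Y)Z$ for horizontal $X,Y$, and $\tau(X):=T(Z,X)$ a symmetric endomorphism of $\mathcal H(\mathbb M)$. Its Ricci tensor is $\mathbf{Ric}(Y,W)=\mathrm{trace}\,(X\mapsto R(X,Y)W)$ with $R(X,Y)=[\nabla_X,\nabla_Y]-\nabla_{[X,Y]}$. In a local orthonormal horizontal frame, $T(X_j,X_k)=-\gamma_{jk}Z$ and $JX_i=\sum_j\gamma_{ij}X_j$. The form $\mathcal R$ is $$\mathcal R(f,f)=\mathbf{Ric}(\nabla_{\mathcal H}f,\nabla_{\mathcal H}f)+\frac n2(Zf)^2-\sum_{l,k=1}^{2n}\Big(\big((\nabla_{X_l}T)(X_l,X_k)f\big)(X_kf)+\big(T(X_l,T(X_l,X_k))f\big)(X_kf)\Big).$$ $\nabla^2_{\mathcal H}f$ is the (symmetrized) horizontal Hessian with respect to $\nabla$, and $\|\cdot\|$ is the Hilbert–Schmidt norm; explicitly, with $f_{,ij}=\frac12(X_iX_j+X_jX_i)f$, $$\|\nabla_{\mathcal H}^2f\|^2=\sum_{\ell=1}^{2n}\Big(f_{,\ell\ell}-\sum_{i=1}^{2n}w_{i\ell}^\ell X_if\Big)^2+2\sum_{1\le\ell<j\le2n}\Big(f_{,j\ell}-\sum_{i=1}^{2n}\frac{w_{ij}^\ell+w_{i\ell}^j}2X_if\Big)^2.$$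 *)

theory Defs
  imports "HOL-Analysis.Analysis" "HOL-Library.Function_Algebras"
begin

text \<open>Real-valued functions, and functionals on them, form real vector spaces pointwise; tangent
  vectors are such functionals, so that \<open>span\<close>, \<open>independent\<close>, \<open>representation\<close> apply to them.\<close>

instantiation "fun" :: (type, real_vector) real_vector
begin

definition scaleR_fun_def: "c *\<^sub>R f = (\<lambda>x. c *\<^sub>R f x)"

instance
  by standard (simp_all add: scaleR_fun_def fun_eq_iff scaleR_add_right scaleR_add_left)

end

text \<open>The sum of the diagonal entries in a basis of \<open>S\<close>; for finite-dimensional \<open>S\<close> and \<open>A\<close> linear from \<open>S\<close>
  to \<open>S\<close> it does not depend on the basis.\<close>

definition trace_on :: "'v::real_vector set \<Rightarrow> ('v \<Rightarrow> 'v) \<Rightarrow> real" where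
  "trace_on S A = (let B = (SOME B. independent B \<and> span B = S)
                   in \<Sum>b\<in>B. representation B (A b) b)"

definition lin_on :: "'v::real_vector set \<Rightarrow> ('v \<Rightarrow> 'w::real_vector) \<Rightarrow> bool" where
  "lin_on S A \<longleftrightarrow> (\<forall>u\<in>S. \<forall>v\<in>S. \<forall>a b. A (a *\<^sub>R u + b *\<^sub>R v) = a *\<^sub>R A u + b *\<^sub>R A v)"


section \<open>Smooth manifolds\<close>

text \<open>Meant for open \<open>S\<close> in a finite-dimensional space.\<close>

primrec Ck_on :: "nat \<Rightarrow> 'a::real_normed_vector set \<Rightarrow> ('a \<Rightarrow> 'b::real_normed_vector) \<Rightarrow> bool" where
  "Ck_on 0 S f \<longleftrightarrow> continuous_on S f"
| "Ck_on (Suc k) S f \<longleftrightarrow> f differentiable_on S \<and>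
     (\<forall>v. Ck_on k S (\<lambda>x. frechet_derivative f (at x) v))"

definition Cinf_on :: "'a::real_normed_vector set \<Rightarrow> ('a \<Rightarrow> 'b::real_normed_vector) \<Rightarrow> bool" where
  "Cinf_on S f \<longleftrightarrow> (\<forall>k. Ck_on k S f)"

text \<open>The manifold is the whole type \<open>'m\<close>; a chart is a pair of its domain and the coordinate map
  into the model space \<open>'e\<close>.\<close>

type_synonym ('m, 'e) atlas = "('m set \<times> ('m \<Rightarrow> 'e)) set"

definition smooth_atlas :: "('m::topological_space, 'e::euclidean_space) atlas \<Rightarrow> bool" where
  "smooth_atlas \<A> \<longleftrightarrow>
     (\<Union>(V, \<phi>)\<in>\<A>. V) = UNIV \<and>
     (\<forall>(V, \<phi>)\<in>\<A>. open V \<and> open (\<phi> ` V) \<and> homeomorphism V (\<phi> ` V) \<phi> (inv_into V \<phi>)) \<and>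
     (\<forall>(V, \<phi>)\<in>\<A>. \<forall>(W, \<psi>)\<in>\<A>. Cinf_on (\<phi> ` (V \<inter> W)) (\<psi> \<circ> inv_into V \<phi>))"

definition smooth_fun :: "('m::topological_space, 'e::euclidean_space) atlas \<Rightarrow> 'm set
    \<Rightarrow> ('m \<Rightarrow> real) \<Rightarrow> bool" where
  "smooth_fun \<A> U f \<longleftrightarrow> (\<forall>(V, \<phi>)\<in>\<A>. Cinf_on (\<phi> ` (V \<inter> U)) (f \<circ> inv_into V \<phi>))"

definition smooth_near :: "('m::topological_space, 'e::euclidean_space) atlas \<Rightarrow> 'm
    \<Rightarrow> ('m \<Rightarrow> real) \<Rightarrow> bool" where
  "smooth_near \<A> p f \<longleftrightarrow> (\<exists>U. open U \<and> p \<in> U \<and> smooth_fun \<A> U f)"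

text \<open>A tangent vector at \<open>p\<close> is a derivation of the algebra of germs at \<open>p\<close> of smooth functions. It is
  represented by a functional on all functions, set to \<open>0\<close> on those that are not smooth near \<open>p\<close>, so
  that equality of functionals is equality of tangent vectors.\<close>

type_synonym 'm tvec = "('m \<Rightarrow> real) \<Rightarrow> real"
type_synonym 'm vfield = "'m \<Rightarrow> 'm tvec"

definition tangent_space :: "('m::topological_space, 'e::euclidean_space) atlas \<Rightarrow> 'm \<Rightarrow> 'm tvec set"
  where
  "tangent_space \<A> p = {v.
     (\<forall>f h. smooth_near \<A> p f \<and> smooth_near \<A> p h \<longrightarrow>
        v (f + h) = v f + v h \<and> v (f * h) = v f * h p + f p * v h) \<and>
     (\<forall>c f. smooth_near \<A> p f \<longrightarrow> v (c *\<^sub>R f) = c * v f) \<and>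
     (\<forall>f h. smooth_near \<A> p f \<and> smooth_near \<A> p h \<and> (\<forall>\<^sub>F q in nhds p. f q = h q) \<longrightarrow> v f = v h) \<and>
     (\<forall>f. \<not> smooth_near \<A> p f \<longrightarrow> v f = 0)}"

definition smooth_vfield :: "('m::topological_space, 'e::euclidean_space) atlas \<Rightarrow> 'm set
    \<Rightarrow> 'm vfield \<Rightarrow> bool" where
  "smooth_vfield \<A> U X \<longleftrightarrow> (\<forall>p\<in>U. X p \<in> tangent_space \<A> p) \<and>
     (\<forall>V f. open V \<and> V \<subseteq> U \<and> smooth_fun \<A> V f \<longrightarrow> smooth_fun \<A> V (\<lambda>p. X p f))"

text \<open>Some smooth local vector field with a prescribed value at \<open>p\<close>; only used in expressions that
  are tensorial in this argument.\<close>

definition extend :: "('m::topological_space, 'e::euclidean_space) atlas \<Rightarrow> 'm \<Rightarrow> 'm tvec \<Rightarrow> 'm vfield"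
  where
  "extend \<A> p v = (SOME X. (\<exists>U. open U \<and> p \<in> U \<and> smooth_vfield \<A> U X) \<and> X p = v)"

definition lie_bracket :: "('m::topological_space, 'e::euclidean_space) atlas
    \<Rightarrow> 'm vfield \<Rightarrow> 'm vfield \<Rightarrow> 'm vfield" where
  "lie_bracket \<A> X Y = (\<lambda>p f.
     if smooth_near \<A> p f then X p (\<lambda>q. Y q f) - Y p (\<lambda>q. X q f) else 0)"


section \<open>Tensor fields\<close>

definition one_form :: "('m::topological_space, 'e::euclidean_space) atlas
    \<Rightarrow> ('m \<Rightarrow> 'm tvec \<Rightarrow> real) \<Rightarrow> bool" where
  "one_form \<A> \<theta> \<longleftrightarrow> (\<forall>p. lin_on (tangent_space \<A> p) (\<theta> p)) \<and>
     (\<forall>U X. open U \<and> smooth_vfield \<A> U X \<longrightarrow> smooth_fun \<A> U (\<lambda>p. \<theta> p (X p)))"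

definition endo_tensor :: "('m::topological_space, 'e::euclidean_space) atlas
    \<Rightarrow> ('m \<Rightarrow> 'm tvec \<Rightarrow> 'm tvec) \<Rightarrow> bool" where
  "endo_tensor \<A> J \<longleftrightarrow>
     (\<forall>p. lin_on (tangent_space \<A> p) (J p) \<and> J p ` tangent_space \<A> p \<subseteq> tangent_space \<A> p) \<and>
     (\<forall>U X. open U \<and> smooth_vfield \<A> U X \<longrightarrow> smooth_vfield \<A> U (\<lambda>p. J p (X p)))"

definition riemannian_metric :: "('m::topological_space, 'e::euclidean_space) atlas
    \<Rightarrow> ('m \<Rightarrow> 'm tvec \<Rightarrow> 'm tvec \<Rightarrow> real) \<Rightarrow> bool" where
  "riemannian_metric \<A> g \<longleftrightarrow>
     (\<forall>p. \<forall>u\<in>tangent_space \<A> p.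
        lin_on (tangent_space \<A> p) (g p u) \<and>
        (\<forall>v\<in>tangent_space \<A> p. g p u v = g p v u) \<and>
        (u \<noteq> 0 \<longrightarrow> g p u u > 0)) \<and>
     (\<forall>U X Y. open U \<and> smooth_vfield \<A> U X \<and> smooth_vfield \<A> U Y \<longrightarrow>
        smooth_fun \<A> U (\<lambda>p. g p (X p) (Y p)))"

definition ext_deriv :: "('m::topological_space, 'e::euclidean_space) atlas
    \<Rightarrow> ('m \<Rightarrow> 'm tvec \<Rightarrow> real) \<Rightarrow> 'm vfield \<Rightarrow> 'm vfield \<Rightarrow> 'm \<Rightarrow> real" where
  "ext_deriv \<A> \<theta> X Y p =
     X p (\<lambda>q. \<theta> q (Y q)) - Y p (\<lambda>q. \<theta> q (X q)) - \<theta> p (lie_bracket \<A> X Y p)"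

text \<open>\<open>\<theta> \<and> (d\<theta>)\<^sup>n\<close> evaluated on \<open>V 0, \<dots>, V (2n)\<close>.\<close>

definition contact_volume :: "('m::topological_space, 'e::euclidean_space) atlas \<Rightarrow> nat
    \<Rightarrow> ('m \<Rightarrow> 'm tvec \<Rightarrow> real) \<Rightarrow> (nat \<Rightarrow> 'm vfield) \<Rightarrow> 'm \<Rightarrow> real" where
  "contact_volume \<A> n \<theta> V p = (1 / 2 ^ n) *
     (\<Sum>\<sigma> | \<sigma> permutes {..2 * n}. of_int (sign \<sigma>) * \<theta> p (V (\<sigma> 0) p) *
        (\<Prod>k<n. ext_deriv \<A> \<theta> (V (\<sigma> (2 * k + 1))) (V (\<sigma> (2 * k + 2))) p))"

definition contact_form :: "('m::topological_space, 'e::euclidean_space) atlas \<Rightarrow> nat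
    \<Rightarrow> ('m \<Rightarrow> 'm tvec \<Rightarrow> real) \<Rightarrow> bool" where
  "contact_form \<A> n \<theta> \<longleftrightarrow> one_form \<A> \<theta> \<and>
     (\<forall>p. \<exists>U V. open U \<and> p \<in> U \<and> (\<forall>i\<le>2 * n. smooth_vfield \<A> U (V i)) \<and>
        contact_volume \<A> n \<theta> V p \<noteq> 0)"

definition reeb_field :: "('m::topological_space, 'e::euclidean_space) atlas
    \<Rightarrow> ('m \<Rightarrow> 'm tvec \<Rightarrow> real) \<Rightarrow> 'm vfield \<Rightarrow> bool" where
  "reeb_field \<A> \<theta> Z \<longleftrightarrow> smooth_vfield \<A> UNIV Z \<and> (\<forall>p. \<theta> p (Z p) = 1) \<and>
     (\<forall>U X. open U \<and> smooth_vfield \<A> U X \<longrightarrow>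
        (\<forall>p\<in>U. Z p (\<lambda>q. \<theta> q (X q)) - \<theta> p (lie_bracket \<A> Z X p) = 0))"

definition contact_riemannian :: "('m::topological_space, 'e::euclidean_space) atlas \<Rightarrow> nat
    \<Rightarrow> ('m \<Rightarrow> 'm tvec \<Rightarrow> real) \<Rightarrow> 'm vfield \<Rightarrow> ('m \<Rightarrow> 'm tvec \<Rightarrow> 'm tvec \<Rightarrow> real)
    \<Rightarrow> ('m \<Rightarrow> 'm tvec \<Rightarrow> 'm tvec) \<Rightarrow> bool" where
  "contact_riemannian \<A> n \<theta> Z g J \<longleftrightarrow>
     smooth_atlas \<A> \<and> DIM('e) = 2 * n + 1 \<and>
     contact_form \<A> n \<theta> \<and> reeb_field \<A> \<theta> Z \<and> riemannian_metric \<A> g \<and> endo_tensor \<A> J \<and>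
     (\<forall>p. \<forall>v\<in>tangent_space \<A> p. g p v (Z p) = \<theta> p v \<and> J p (J p v) = - v + \<theta> p v *\<^sub>R Z p) \<and>
     (\<forall>U X Y. open U \<and> smooth_vfield \<A> U X \<and> smooth_vfield \<A> U Y \<longrightarrow>
        (\<forall>p\<in>U. g p (X p) (J p (Y p)) = ext_deriv \<A> \<theta> X Y p))"

definition horizontal_space :: "('m::topological_space, 'e::euclidean_space) atlas
    \<Rightarrow> ('m \<Rightarrow> 'm tvec \<Rightarrow> real) \<Rightarrow> 'm \<Rightarrow> 'm tvec set" where
  "horizontal_space \<A> \<theta> p = {v \<in> tangent_space \<A> p. \<theta> p v = 0}"


section \<open>Riemannian distance and completeness\<close>

definition smooth_curve :: "('m::topological_space, 'e::euclidean_space) atlas \<Rightarrow> real set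
    \<Rightarrow> (real \<Rightarrow> 'm) \<Rightarrow> bool" where
  "smooth_curve \<A> I c \<longleftrightarrow> continuous_on I c \<and>
     (\<forall>V f. open V \<and> smooth_fun \<A> V f \<longrightarrow> Cinf_on (I \<inter> c -` V) (f \<circ> c))"

definition piecewise_smooth_path :: "('m::topological_space, 'e::euclidean_space) atlas
    \<Rightarrow> (real \<Rightarrow> 'm) \<Rightarrow> bool" where
  "piecewise_smooth_path \<A> c \<longleftrightarrow> path c \<and>
     (\<exists>S. finite S \<and> (\<forall>a b. 0 \<le> a \<and> a < b \<and> b \<le> 1 \<and> {a<..<b} \<inter> S = {} \<longrightarrow>
        (\<exists>I c'. open I \<and> {a..b} \<subseteq> I \<and> smooth_curve \<A> I c' \<and> (\<forall>t\<in>{a..b}. c' t = c t))))"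

definition velocity :: "('m::topological_space, 'e::euclidean_space) atlas \<Rightarrow> (real \<Rightarrow> 'm)
    \<Rightarrow> real \<Rightarrow> 'm tvec" where
  "velocity \<A> c t = (\<lambda>f. if smooth_near \<A> (c t) f then deriv (f \<circ> c) t else 0)"

definition riem_length :: "('m::topological_space, 'e::euclidean_space) atlas
    \<Rightarrow> ('m \<Rightarrow> 'm tvec \<Rightarrow> 'm tvec \<Rightarrow> real) \<Rightarrow> (real \<Rightarrow> 'm) \<Rightarrow> ennreal" where
  "riem_length \<A> g c =
     (\<integral>\<^sup>+t\<in>{0..1}. ennreal (sqrt (g (c t) (velocity \<A> c t) (velocity \<A> c t))) \<partial>lborel)"

definition riem_dist :: "('m::topological_space, 'e::euclidean_space) atlas
    \<Rightarrow> ('m \<Rightarrow> 'm tvec \<Rightarrow> 'm tvec \<Rightarrow> real) \<Rightarrow> 'm \<Rightarrow> 'm \<Rightarrow> ennreal" where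
  "riem_dist \<A> g x y =
     (INF c\<in>{c. piecewise_smooth_path \<A> c \<and> pathstart c = x \<and> pathfinish c = y}. riem_length \<A> g c)"

definition riem_complete :: "('m::topological_space, 'e::euclidean_space) atlas
    \<Rightarrow> ('m \<Rightarrow> 'm tvec \<Rightarrow> 'm tvec \<Rightarrow> real) \<Rightarrow> bool" where
  "riem_complete \<A> g \<longleftrightarrow> (\<forall>s :: nat \<Rightarrow> 'm.
     (\<forall>e>0. \<exists>N. \<forall>m\<ge>N. \<forall>k\<ge>N. riem_dist \<A> g (s m) (s k) < e) \<longrightarrow>
     (\<exists>l. (\<lambda>k. riem_dist \<A> g (s k) l) \<longlonglongrightarrow> 0))"


section \<open>Linear connections\<close>

text \<open>A linear connection, acting on smooth vector fields over arbitrary open sets. Vector fields are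
  total functions whose values outside of the open set under consideration are irrelevant; the first
  condition expresses this together with compatibility with restriction.\<close>

definition linear_connection :: "('m::topological_space, 'e::euclidean_space) atlas
    \<Rightarrow> ('m vfield \<Rightarrow> 'm vfield \<Rightarrow> 'm vfield) \<Rightarrow> bool" where
  "linear_connection \<A> D \<longleftrightarrow> (\<forall>U X Y. open U \<and> smooth_vfield \<A> U X \<and> smooth_vfield \<A> U Y \<longrightarrow>
     (\<forall>X' Y'. (\<forall>p\<in>U. X' p = X p \<and> Y' p = Y p) \<longrightarrow> (\<forall>p\<in>U. D X' Y' p = D X Y p)) \<and>
     smooth_vfield \<A> U (D X Y) \<and>
     (\<forall>W. smooth_vfield \<A> U W \<longrightarrow> (\<forall>p\<in>U.
        D (X + W) Y p = D X Y p + D W Y p \<and> D X (Y + W) p = D X Y p + D X W p)) \<and>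
     (\<forall>f. smooth_fun \<A> U f \<longrightarrow> (\<forall>p\<in>U.
        D (\<lambda>q. f q *\<^sub>R X q) Y p = f p *\<^sub>R D X Y p \<and>
        D X (\<lambda>q. f q *\<^sub>R Y q) p = f p *\<^sub>R D X Y p + X p f *\<^sub>R Y p)))"

definition torsion :: "('m::topological_space, 'e::euclidean_space) atlas
    \<Rightarrow> ('m vfield \<Rightarrow> 'm vfield \<Rightarrow> 'm vfield) \<Rightarrow> 'm vfield \<Rightarrow> 'm vfield \<Rightarrow> 'm vfield" where
  "torsion \<A> D X Y = D X Y - D Y X - lie_bracket \<A> X Y"

definition cov_torsion :: "('m::topological_space, 'e::euclidean_space) atlas
    \<Rightarrow> ('m vfield \<Rightarrow> 'm vfield \<Rightarrow> 'm vfield) \<Rightarrow> 'm vfield \<Rightarrow> 'm vfield \<Rightarrow> 'm vfield \<Rightarrow> 'm vfield" where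
  "cov_torsion \<A> D W X Y =
     D W (torsion \<A> D X Y) - torsion \<A> D (D W X) Y - torsion \<A> D X (D W Y)"

definition curvature :: "('m::topological_space, 'e::euclidean_space) atlas
    \<Rightarrow> ('m vfield \<Rightarrow> 'm vfield \<Rightarrow> 'm vfield) \<Rightarrow> 'm vfield \<Rightarrow> 'm vfield \<Rightarrow> 'm vfield \<Rightarrow> 'm vfield" where
  "curvature \<A> D X Y W = D X (D Y W) - D Y (D X W) - D (lie_bracket \<A> X Y) W"

definition ricci :: "('m::topological_space, 'e::euclidean_space) atlas
    \<Rightarrow> ('m vfield \<Rightarrow> 'm vfield \<Rightarrow> 'm vfield) \<Rightarrow> 'm vfield \<Rightarrow> 'm vfield \<Rightarrow> 'm \<Rightarrow> real" where
  "ricci \<A> D Y W p =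
     trace_on (tangent_space \<A> p) (\<lambda>v. curvature \<A> D (extend \<A> p v) Y W p)"

definition metric_connection :: "('m::topological_space, 'e::euclidean_space) atlas
    \<Rightarrow> ('m \<Rightarrow> 'm tvec \<Rightarrow> 'm tvec \<Rightarrow> real) \<Rightarrow> ('m vfield \<Rightarrow> 'm vfield \<Rightarrow> 'm vfield) \<Rightarrow> bool" where
  "metric_connection \<A> g D \<longleftrightarrow> linear_connection \<A> D \<and>
     (\<forall>U X Y W. open U \<and> smooth_vfield \<A> U X \<and> smooth_vfield \<A> U Y \<and> smooth_vfield \<A> U W \<longrightarrow>
        (\<forall>p\<in>U. X p (\<lambda>q. g q (Y q) (W q)) = g p (D X Y p) (W p) + g p (Y p) (D X W p)))"

definition levi_civita :: "('m::topological_space, 'e::euclidean_space) atlas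
    \<Rightarrow> ('m \<Rightarrow> 'm tvec \<Rightarrow> 'm tvec \<Rightarrow> real) \<Rightarrow> ('m vfield \<Rightarrow> 'm vfield \<Rightarrow> 'm vfield) \<Rightarrow> bool" where
  "levi_civita \<A> g D \<longleftrightarrow> metric_connection \<A> g D \<and>
     (\<forall>U X Y. open U \<and> smooth_vfield \<A> U X \<and> smooth_vfield \<A> U Y \<longrightarrow>
        (\<forall>p\<in>U. torsion \<A> D X Y p = 0))"

text \<open>In the last condition, \<open>\<theta> (T(Z,X)) = 0\<close> says that \<open>\<tau> = T(Z,\<cdot>)\<close> maps horizontal vectors to
  horizontal vectors.\<close>

definition tanno_connection :: "('m::topological_space, 'e::euclidean_space) atlas
    \<Rightarrow> ('m \<Rightarrow> 'm tvec \<Rightarrow> real) \<Rightarrow> 'm vfield \<Rightarrow> ('m \<Rightarrow> 'm tvec \<Rightarrow> 'm tvec \<Rightarrow> real)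
    \<Rightarrow> ('m vfield \<Rightarrow> 'm vfield \<Rightarrow> 'm vfield) \<Rightarrow> bool" where
  "tanno_connection \<A> \<theta> Z g D \<longleftrightarrow> metric_connection \<A> g D \<and>
     (\<forall>U X Y. open U \<and> smooth_vfield \<A> U X \<and> smooth_vfield \<A> U Y \<longrightarrow>
        (\<forall>p\<in>U. X p (\<lambda>q. \<theta> q (Y q)) - \<theta> p (D X Y p) = 0 \<and> D X Z p = 0)) \<and>
     (\<forall>U X Y. open U \<and> smooth_vfield \<A> U X \<and> smooth_vfield \<A> U Y \<and>
          (\<forall>p\<in>U. \<theta> p (X p) = 0 \<and> \<theta> p (Y p) = 0) \<longrightarrow>
        (\<forall>p\<in>U. torsion \<A> D X Y p = ext_deriv \<A> \<theta> X Y p *\<^sub>R Z p \<and>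
           \<theta> p (torsion \<A> D Z X p) = 0 \<and>
           g p (torsion \<A> D Z X p) (Y p) = g p (X p) (torsion \<A> D Z Y p)))"


section \<open>Sub-Laplacian and Gamma calculus\<close>

definition gradient :: "('m::topological_space, 'e::euclidean_space) atlas
    \<Rightarrow> ('m \<Rightarrow> 'm tvec \<Rightarrow> 'm tvec \<Rightarrow> real) \<Rightarrow> ('m \<Rightarrow> real) \<Rightarrow> 'm vfield" where
  "gradient \<A> g f = (\<lambda>p. THE v. v \<in> tangent_space \<A> p \<and> (\<forall>w\<in>tangent_space \<A> p. g p v w = w f))"

definition horizontal_gradient :: "('m::topological_space, 'e::euclidean_space) atlas
    \<Rightarrow> ('m \<Rightarrow> 'm tvec \<Rightarrow> real) \<Rightarrow> ('m \<Rightarrow> 'm tvec \<Rightarrow> 'm tvec \<Rightarrow> real) \<Rightarrow> ('m \<Rightarrow> real) \<Rightarrow> 'm vfield" where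
  "horizontal_gradient \<A> \<theta> g f = (\<lambda>p. THE h. h \<in> horizontal_space \<A> \<theta> p \<and>
     (\<forall>w\<in>horizontal_space \<A> \<theta> p. g p (gradient \<A> g f p - h) w = 0))"

text \<open>In the next two definitions \<open>D\<close> is the Levi-Civita connection of \<open>g\<close>, and the Laplacian is the
  divergence of the gradient. On a contact Riemannian manifold \<open>\<Delta>\<^sub>g - Z\<^sup>2\<close> is the operator \<open>L\<close> with
  \<open>\<integral> (L f) h d\<mu> = - \<integral> \<langle>\<nabla>\<^sub>H f, \<nabla>\<^sub>H h\<rangle> d\<mu>\<close> for the measure \<open>\<mu>\<close> given by \<open>\<theta> \<and> (d\<theta>)\<^sup>n\<close>.\<close>

definition laplace_beltrami :: "('m::topological_space, 'e::euclidean_space) atlas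
    \<Rightarrow> ('m \<Rightarrow> 'm tvec \<Rightarrow> 'm tvec \<Rightarrow> real) \<Rightarrow> ('m vfield \<Rightarrow> 'm vfield \<Rightarrow> 'm vfield)
    \<Rightarrow> ('m \<Rightarrow> real) \<Rightarrow> 'm \<Rightarrow> real" where
  "laplace_beltrami \<A> g D f p =
     trace_on (tangent_space \<A> p) (\<lambda>v. D (extend \<A> p v) (gradient \<A> g f) p)"

definition sub_laplacian :: "('m::topological_space, 'e::euclidean_space) atlas \<Rightarrow> 'm vfield
    \<Rightarrow> ('m \<Rightarrow> 'm tvec \<Rightarrow> 'm tvec \<Rightarrow> real) \<Rightarrow> ('m vfield \<Rightarrow> 'm vfield \<Rightarrow> 'm vfield)
    \<Rightarrow> ('m \<Rightarrow> real) \<Rightarrow> 'm \<Rightarrow> real" where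
  "sub_laplacian \<A> Z g D f p = laplace_beltrami \<A> g D f p - Z p (\<lambda>q. Z q f)"

definition Gam :: "(('m \<Rightarrow> real) \<Rightarrow> 'm \<Rightarrow> real) \<Rightarrow> ('m \<Rightarrow> real) \<Rightarrow> ('m \<Rightarrow> real) \<Rightarrow> 'm \<Rightarrow> real" where
  "Gam L f h p = (1/2) * (L (\<lambda>q. f q * h q) p - f p * L h p - h p * L f p)"

definition Gam2 :: "(('m \<Rightarrow> real) \<Rightarrow> 'm \<Rightarrow> real) \<Rightarrow> ('m \<Rightarrow> real) \<Rightarrow> 'm \<Rightarrow> real" where
  "Gam2 L f p = (1/2) * (L (Gam L f f) p - 2 * Gam L f (L f) p)"


section \<open>Local horizontal frames\<close>

definition horizontal_frame :: "('m::topological_space, 'e::euclidean_space) atlas \<Rightarrow> nat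
    \<Rightarrow> ('m \<Rightarrow> 'm tvec \<Rightarrow> real) \<Rightarrow> ('m \<Rightarrow> 'm tvec \<Rightarrow> 'm tvec \<Rightarrow> real) \<Rightarrow> 'm set
    \<Rightarrow> (nat \<Rightarrow> 'm vfield) \<Rightarrow> bool" where
  "horizontal_frame \<A> n \<theta> g U X \<longleftrightarrow> open U \<and> (\<forall>i\<in>{1..2 * n}. smooth_vfield \<A> U (X i)) \<and>
     (\<forall>p\<in>U. span ((\<lambda>i. X i p) ` {1..2 * n}) = horizontal_space \<A> \<theta> p \<and>
        (\<forall>i\<in>{1..2 * n}. \<forall>j\<in>{1..2 * n}. g p (X i p) (X j p) = (if i = j then 1 else 0)))"

definition sym_hessian :: "('m vfield \<Rightarrow> 'm vfield \<Rightarrow> 'm vfield) \<Rightarrow> ('m \<Rightarrow> real)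
    \<Rightarrow> 'm vfield \<Rightarrow> 'm vfield \<Rightarrow> 'm \<Rightarrow> real" where
  "sym_hessian D f X Y p =
     (1/2) * ((X p (\<lambda>q. Y q f) - D X Y p f) + (Y p (\<lambda>q. X q f) - D Y X p f))"

text \<open>The squared Hilbert--Schmidt norm on the horizontal space of the symmetrized Hessian, computed
  in the orthonormal horizontal frame \<open>X\<close>.\<close>

definition hessian_norm_sq :: "nat \<Rightarrow> ('m vfield \<Rightarrow> 'm vfield \<Rightarrow> 'm vfield) \<Rightarrow> (nat \<Rightarrow> 'm vfield)
    \<Rightarrow> ('m \<Rightarrow> real) \<Rightarrow> 'm \<Rightarrow> real" where
  "hessian_norm_sq n D X f p = (\<Sum>i=1..2 * n. \<Sum>j=1..2 * n. (sym_hessian D f (X i) (X j) p)\<^sup>2)"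

definition R_form :: "('m::topological_space, 'e::euclidean_space) atlas \<Rightarrow> nat
    \<Rightarrow> ('m \<Rightarrow> 'm tvec \<Rightarrow> real) \<Rightarrow> 'm vfield \<Rightarrow> ('m \<Rightarrow> 'm tvec \<Rightarrow> 'm tvec \<Rightarrow> real)
    \<Rightarrow> ('m vfield \<Rightarrow> 'm vfield \<Rightarrow> 'm vfield) \<Rightarrow> (nat \<Rightarrow> 'm vfield) \<Rightarrow> ('m \<Rightarrow> real) \<Rightarrow> 'm \<Rightarrow> real" where
  "R_form \<A> n \<theta> Z g D X f p =
     ricci \<A> D (horizontal_gradient \<A> \<theta> g f) (horizontal_gradient \<A> \<theta> g f) p
     + real n / 2 * (Z p f)\<^sup>2
     - (\<Sum>l=1..2 * n. \<Sum>k=1..2 * n.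
          cov_torsion \<A> D (X l) (X l) (X k) p f * X k p f
          + torsion \<A> D (X l) (torsion \<A> D (X l) (X k)) p f * X k p f)"

end

theory Submission
  imports Defs
begin

text \<open>Let \<open>G\<close> be the horizontal gradient of \<open>f\<close>. Tanno's connection \<open>D\<close> is metric and preserves
  horizontality, so the Hessian on horizontal fields is \<open>\<langle>D Y G, W\<rangle>\<close>, the sub-Laplacian of \<open>f\<close> is its
  trace, and \<open>\<Gamma>\<^sub>2 f\<close> becomes \<open>\<Sum>i. |D (X i) G|\<^sup>2\<close> plus third-order terms. Commuting \<open>D (X i)\<close> with
  \<open>D G\<close> in the latter produces the Ricci term. The skew part of the Hessian is \<open>- d\<theta>(Y, W) Z f / 2\<close>:
  differentiating it gives the torsion terms and the term with \<open>X j (Z f)\<close>, and since \<open>J\<^sup>2 = -1\<close> on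
  horizontal vectors its squared norm is \<open>n / 2 * (Z f)\<^sup>2\<close>.\<close>

section \<open>Smooth functions and vector fields\<close>

text \<open>\<open>sub_laplacian\<close> is built from the Levi-Civita connection, the formula from
  Tanno's. That both give the same second-order operator uses \<open>\<delta> i i = 0\<close>: the
  sum of these coefficients is the divergence of \<open>Z\<close>. The frame is given and cannot be
  chosen parallel at the point, so \<open>D (X i) (X i)\<close> and \<open>D G (X i)\<close>
  survive. Of the former, one part cancels and the other completes a derivative of d\<theta> to a
  covariant derivative of the torsion; the latter disappear only after summation over the frame. The
  factor 2 before the terms with \<open>X j (Z f)\<close> has two equal sources: differentiating the
  skew part of the Hessian along \<open>X i\<close>, and the \<open>Z\<close>-component of the
  bracket of \<open>X i\<close> and \<open>G\<close> inside the curvature. The constant n/2 is a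
  quarter of 2n, the sum of the squares of d\<theta> over the frame. The remaining obstacle is
  locality. Fields are total functions with meaning on \<open>U\<close> only, so identities between
  them are used as equalities of germs; and \<open>extend\<close> picks an unspecified field, so
  traces can be evaluated in a frame only once tensoriality is known.\<close>

lemma Ck_on_cong:
  assumes "open S" "\<And>x. x \<in> S \<Longrightarrow> f x = h x" "Ck_on k S f"
  shows "Ck_on k S h"
  using assms(2,3)
proof (induction k arbitrary: f h)
  case 0
  then show ?case using continuous_on_cong by (metis Ck_on.simps(1))
next
  case (Suc k)
  \<comment> \<open>Since \<open>S\<close> is open, the derivative at \<open>x\<close> depends on
    the germ only; so the derivatives agree on \<open>S\<close> as well and the induction can
    descend to them.\<close>
  have d: "(h has_derivative frechet_derivative f (at x)) (at x)" if "x \<in> S" for x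
  proof (rule has_derivative_transform_within_open[OF _ \<open>open S\<close> that])
    show "(f has_derivative frechet_derivative f (at x)) (at x)"
      using Suc.prems(2) that \<open>open S\<close> differentiable_on_eq_differentiable_at frechet_derivative_works
      by (metis Ck_on.simps(2))
  qed (use Suc.prems in auto)
  have e: "frechet_derivative f (at x) = frechet_derivative h (at x)" if "x \<in> S" for x
    using frechet_derivative_at[OF d[OF that]] .
  have "h differentiable_on S"
    unfolding differentiable_on_def
    using d has_derivative_at_withinI differentiable_def by blast
  moreover have "Ck_on k S (\<lambda>x. frechet_derivative h (at x) v)" for v
    by (rule Suc.IH[of "\<lambda>x. frechet_derivative f (at x) v"]) (use e Suc.prems in auto)
  ultimately show ?case by simp
qed

lemma Ck_on_Suc_imp: "Ck_on (Suc k) S f \<Longrightarrow> Ck_on k S f"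
proof (induction k arbitrary: f)
  case 0
  then show ?case using differentiable_imp_continuous_on by auto
next
  case (Suc k)
  then show ?case by (metis Ck_on.simps(2))
qed

lemma Ck_on_subset:
  assumes "T \<subseteq> S" shows "Ck_on k S f \<Longrightarrow> Ck_on k T f"
proof (induction k arbitrary: f)
  case 0
  then show ?case using assms continuous_on_subset by auto
next
  case (Suc k)
  then show ?case using assms differentiable_on_subset by auto
qed

lemma Ck_on_const: "Ck_on k S (\<lambda>_. c)"
  by (induction k arbitrary: c) auto

lemma Ck_on_add:
  assumes "open S"
  shows "Ck_on k S f \<Longrightarrow> Ck_on k S h \<Longrightarrow> Ck_on k S (\<lambda>x. f x + h x)"
proof (induction k arbitrary: f h)
  case 0
  then show ?case by (auto intro: continuous_intros)
next
  case (Suc k)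
  have d: "f differentiable at x" "h differentiable at x" if "x \<in> S" for x
    using Suc.prems that assms differentiable_on_eq_differentiable_at by (metis Ck_on.simps(2))+
  have "Ck_on k S (\<lambda>x. frechet_derivative (\<lambda>x. f x + h x) (at x) v)" for v
  proof (rule Ck_on_cong[OF assms])
    show "Ck_on k S (\<lambda>x. frechet_derivative f (at x) v + frechet_derivative h (at x) v)"
      using Suc.prems by (intro Suc.IH) auto
    show "frechet_derivative f (at x) v + frechet_derivative h (at x) v =
        frechet_derivative (\<lambda>x. f x + h x) (at x) v" if "x \<in> S" for x
      using frechet_derivative_at[OF has_derivative_add[OF
            frechet_derivative_works[THEN iffD1, OF d(1)[OF that]]
            frechet_derivative_works[THEN iffD1, OF d(2)[OF that]]]]
      by (auto dest: fun_cong[of _ _ v])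
  qed
  then show ?case using Suc.prems by auto
qed

lemma Ck_on_mult:
  fixes f h :: "'a::real_normed_vector \<Rightarrow> real"
  assumes "open S"
  shows "Ck_on k S f \<Longrightarrow> Ck_on k S h \<Longrightarrow> Ck_on k S (\<lambda>x. f x * h x)"
proof (induction k arbitrary: f h)
  case 0
  then show ?case by (auto intro: continuous_intros)
next
  case (Suc k)
  have d: "f differentiable at x" "h differentiable at x" if "x \<in> S" for x
    using Suc.prems that assms differentiable_on_eq_differentiable_at by (metis Ck_on.simps(2))+
  \<comment> \<open>The product rule leaves one factor undifferentiated, so the factors themselves
    are needed at level \<open>k\<close>.\<close>
  have fh: "Ck_on k S f" "Ck_on k S h"
    using Suc.prems Ck_on_Suc_imp by auto
  have "Ck_on k S (\<lambda>x. frechet_derivative (\<lambda>x. f x * h x) (at x) v)" for v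
  proof (rule Ck_on_cong[OF assms])
    show "Ck_on k S (\<lambda>x. f x * frechet_derivative h (at x) v + frechet_derivative f (at x) v * h x)"
      using Suc.prems fh by (intro Ck_on_add Suc.IH assms) auto
    show "f x * frechet_derivative h (at x) v + frechet_derivative f (at x) v * h x =
        frechet_derivative (\<lambda>x. f x * h x) (at x) v" if "x \<in> S" for x
      using frechet_derivative_at[OF has_derivative_mult[OF
            frechet_derivative_works[THEN iffD1, OF d(1)[OF that]]
            frechet_derivative_works[THEN iffD1, OF d(2)[OF that]]]]
      by (auto dest: fun_cong[of _ _ v])
  qed
  then show ?case using Suc.prems by (auto intro!: differentiable_on_mult)
qed

section \<open>Smooth functions read in charts\<close>

lemma inv_into_chart_mem:
  assumes "smooth_atlas \<A>" "(V, \<phi>) \<in> \<A>" "y \<in> \<phi> ` (V \<inter> U)"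
  shows "inv_into V \<phi> y \<in> V \<inter> U"
proof -
  have "homeomorphism V (\<phi> ` V) \<phi> (inv_into V \<phi>)"
    using assms by (auto simp: smooth_atlas_def)
  then show ?thesis
    using assms(3) by (auto simp: homeomorphism_def)
qed

lemma open_chart_image:
  assumes "smooth_atlas \<A>" "(V, \<phi>) \<in> \<A>" "open U"
  shows "open (\<phi> ` (V \<inter> U))"
proof -
  have h: "homeomorphism V (\<phi> ` V) \<phi> (inv_into V \<phi>)" and o: "open (\<phi> ` V)" "open V"
    using assms by (auto simp: smooth_atlas_def)
  have "openin (top_of_set (\<phi> ` V)) (\<phi> ` (V \<inter> U))"
    using homeomorphism_imp_open_map[OF h] assms(3) by (simp add: openin_open_Int)
  then show ?thesis using o openin_open_eq by blast
qed

text \<open>Chart inverses take \<open>\<phi>\<close>-images of points of \<open>U\<close> back into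
  \<open>U\<close>, so values outside \<open>U\<close> never enter. Needed because formulas for
  total functions are available on \<open>U\<close> only.\<close>

lemma smooth_fun_cong:
  assumes "smooth_atlas \<A>" "open U" "\<And>q. q \<in> U \<Longrightarrow> f q = h q" "smooth_fun \<A> U f"
  shows "smooth_fun \<A> U h"
  unfolding smooth_fun_def
proof clarify
  fix V \<phi> assume c: "(V, \<phi>) \<in> \<A>"
  have *: "(f \<circ> inv_into V \<phi>) y = (h \<circ> inv_into V \<phi>) y" if "y \<in> \<phi> ` (V \<inter> U)" for y
    using inv_into_chart_mem[OF assms(1) c that] assms(3) by simp
  show "Cinf_on (\<phi> ` (V \<inter> U)) (h \<circ> inv_into V \<phi>)"
    unfolding Cinf_on_def
  proof
    fix k
    show "Ck_on k (\<phi> ` (V \<inter> U)) (h \<circ> inv_into V \<phi>)"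
      by (rule Ck_on_cong[OF open_chart_image[OF assms(1) c assms(2)] *])
         (use assms(4) c in \<open>auto simp: smooth_fun_def Cinf_on_def simp del: o_apply comp_apply\<close>)
  qed
qed

lemma smooth_fun_subset: "U' \<subseteq> U \<Longrightarrow> smooth_fun \<A> U f \<Longrightarrow> smooth_fun \<A> U' f"
  unfolding smooth_fun_def Cinf_on_def
  by (fast intro: Ck_on_subset[rotated] image_mono)

lemma smooth_fun_const: "smooth_fun \<A> U (\<lambda>_. c)"
  by (auto simp: smooth_fun_def Cinf_on_def comp_def Ck_on_const)

lemma smooth_fun_add:
  assumes "smooth_atlas \<A>" "open U" "smooth_fun \<A> U f" "smooth_fun \<A> U h"
  shows "smooth_fun \<A> U (\<lambda>q. f q + h q)"
  using assms(3,4) open_chart_image[OF assms(1) _ assms(2)]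
  unfolding smooth_fun_def Cinf_on_def comp_def
  by (fast intro: Ck_on_add)

lemma smooth_fun_mult:
  assumes "smooth_atlas \<A>" "open U" "smooth_fun \<A> U f" "smooth_fun \<A> U h"
  shows "smooth_fun \<A> U (\<lambda>q. f q * h q)"
  using assms(3,4) open_chart_image[OF assms(1) _ assms(2)]
  unfolding smooth_fun_def Cinf_on_def comp_def
  by (fast intro: Ck_on_mult)

lemma smooth_fun_diff:
  assumes "smooth_atlas \<A>" "open U" "smooth_fun \<A> U f" "smooth_fun \<A> U h"
  shows "smooth_fun \<A> U (\<lambda>q. f q - h q)"
  using smooth_fun_add[OF assms(1-3) smooth_fun_mult[OF assms(1,2) smooth_fun_const assms(4)], of "-1"]
  by simp

lemma smooth_fun_sum:
  assumes "smooth_atlas \<A>" "open U" "\<And>i. i \<in> I \<Longrightarrow> smooth_fun \<A> U (f i)"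
  shows "smooth_fun \<A> U (\<lambda>q. \<Sum>i\<in>I. f i q)"
  using assms(3)
  by (induction I rule: infinite_finite_induct)
     (auto intro: smooth_fun_const smooth_fun_add[OF assms(1,2)])

lemma smooth_nearI: "open U \<Longrightarrow> p \<in> U \<Longrightarrow> smooth_fun \<A> U f \<Longrightarrow> smooth_near \<A> p f"
  by (auto simp: smooth_near_def)

lemma smooth_near_obtain2:
  assumes "smooth_near \<A> p f" "smooth_near \<A> p h"
  obtains U where "open U" "p \<in> U" "smooth_fun \<A> U f" "smooth_fun \<A> U h"
proof -
  obtain U1 U2 where "open U1" "p \<in> U1" "smooth_fun \<A> U1 f" "open U2" "p \<in> U2" "smooth_fun \<A> U2 h"
    using assms by (auto simp: smooth_near_def)
  then show ?thesis
    using that[of "U1 \<inter> U2"] smooth_fun_subset[of "U1 \<inter> U2"] by auto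
qed

lemma smooth_near_const: "smooth_near \<A> p (\<lambda>_. c)"
  by (rule smooth_nearI[of UNIV, OF _ _ smooth_fun_const]) auto

lemma smooth_near_add:
  assumes "smooth_atlas \<A>" "smooth_near \<A> p f" "smooth_near \<A> p h"
  shows "smooth_near \<A> p (\<lambda>q. f q + h q)"
  by (rule smooth_near_obtain2[OF assms(2,3)], rule smooth_nearI[OF _ _ smooth_fun_add[OF assms(1)]])

lemma smooth_near_mult:
  assumes "smooth_atlas \<A>" "smooth_near \<A> p f" "smooth_near \<A> p h"
  shows "smooth_near \<A> p (\<lambda>q. f q * h q)"
  by (rule smooth_near_obtain2[OF assms(2,3)], rule smooth_nearI[OF _ _ smooth_fun_mult[OF assms(1)]])

lemma smooth_near_sum:
  assumes "smooth_atlas \<A>" "\<And>i. i \<in> I \<Longrightarrow> smooth_near \<A> p (f i)"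
  shows "smooth_near \<A> p (\<lambda>q. \<Sum>i\<in>I. f i q)"
  using assms(2)
  by (induction I rule: infinite_finite_induct)
     (auto intro: smooth_near_const smooth_near_add[OF assms(1)])

lemma smooth_near_cong:
  assumes "smooth_atlas \<A>" "open U" "p \<in> U" "\<And>q. q \<in> U \<Longrightarrow> f q = h q" "smooth_near \<A> p f"
  shows "smooth_near \<A> p h"
proof -
  obtain W where W: "open W" "p \<in> W" "smooth_fun \<A> W f"
    using assms(5) by (auto simp: smooth_near_def)
  have "smooth_fun \<A> (W \<inter> U) h"
    by (rule smooth_fun_cong[OF assms(1) _ _ smooth_fun_subset[OF _ W(3)]])
       (use W assms in auto)
  then show ?thesis
    using W assms by (intro smooth_nearI[of "W \<inter> U"]) auto
qed

section \<open>Tangent vectors as local derivations\<close>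

lemma tv_add:
  assumes "v \<in> tangent_space \<A> p" "smooth_near \<A> p f" "smooth_near \<A> p h"
  shows "v (\<lambda>q. f q + h q) = v f + v h"
  using assms by (auto simp: tangent_space_def plus_fun_def)

lemma tv_mult:
  assumes "v \<in> tangent_space \<A> p" "smooth_near \<A> p f" "smooth_near \<A> p h"
  shows "v (\<lambda>q. f q * h q) = v f * h p + f p * v h"
  using assms by (auto simp: tangent_space_def times_fun_def)

lemma tv_cmult:
  assumes "v \<in> tangent_space \<A> p" "smooth_near \<A> p f"
  shows "v (\<lambda>q. c * f q) = c * v f"
  using assms by (auto simp: tangent_space_def scaleR_fun_def)

text \<open>The Leibniz rule for 1 * 1 = 1 gives v 1 = 2 * v 1; homogeneity does the rest.\<close>

lemma tv_const:
  assumes "v \<in> tangent_space \<A> p"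
  shows "v (\<lambda>_. c) = 0"
proof -
  have "v (\<lambda>_. 1) = v (\<lambda>_. 1) * 1 + 1 * v (\<lambda>_. 1)"
    using tv_mult[OF assms smooth_near_const smooth_near_const, of 1 1] by simp
  then show ?thesis
    using tv_cmult[OF assms smooth_near_const, of c 1] by simp
qed

lemma tv_diff:
  assumes "v \<in> tangent_space \<A> p" "smooth_near \<A> p f" "smooth_near \<A> p h" "smooth_atlas \<A>"
  shows "v (\<lambda>q. f q - h q) = v f - v h"
  using tv_add[OF assms(1,2) smooth_near_mult[OF assms(4) smooth_near_const assms(3)], of "-1"]
    tv_cmult[OF assms(1,3), of "-1"]
  by simp

lemma tv_sum:
  assumes "v \<in> tangent_space \<A> p" "\<And>i. i \<in> I \<Longrightarrow> smooth_near \<A> p (f i)" "smooth_atlas \<A>"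
  shows "v (\<lambda>q. \<Sum>i\<in>I. f i q) = (\<Sum>i\<in>I. v (f i))"
  using assms(2)
proof (induction I rule: infinite_finite_induct)
  case (insert i I)
  then show ?case
    using tv_add[OF assms(1), of "f i" "\<lambda>q. \<Sum>i\<in>I. f i q"] smooth_near_sum[OF assms(3), of I p f] by auto
qed (use tv_const[OF assms(1)] in auto)

text \<open>The germ clause of \<open>tangent_space\<close> asks for smoothness of both functions;
  that of \<open>h\<close> is inherited from \<open>f\<close> across \<open>U\<close>. Nearly every
  later rewriting under a derivative is an instance.\<close>

lemma tv_cong:
  assumes "v \<in> tangent_space \<A> p" "smooth_atlas \<A>" "smooth_near \<A> p f"
    and "open U" "p \<in> U" "\<And>q. q \<in> U \<Longrightarrow> f q = h q"
  shows "v f = v h"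
proof -
  have "smooth_near \<A> p h"
    using smooth_near_cong[OF assms(2,4,5,6,3)] .
  moreover have "\<forall>\<^sub>F q in nhds p. f q = h q"
    using assms(4-6) eventually_nhds by blast
  ultimately show ?thesis
    using assms(1,3) by (auto simp: tangent_space_def)
qed

lemma tv_not_smooth: "v \<in> tangent_space \<A> p \<Longrightarrow> \<not> smooth_near \<A> p f \<Longrightarrow> v f = 0"
  by (auto simp: tangent_space_def)

lemma subspace_tangent_space: "subspace (tangent_space \<A> p)"
  unfolding subspace_def
  by (auto simp: tangent_space_def scaleR_fun_def algebra_simps)

lemma tvec_sum_apply: "(\<Sum>i\<in>I. v i) f = (\<Sum>i\<in>I. v i f)"
  for v :: "'i \<Rightarrow> ('a \<Rightarrow> 'b::comm_monoid_add)"
  by (induction I rule: infinite_finite_induct) auto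

lemmas tvec_apply = plus_fun_apply minus_apply scaleR_fun_def tvec_sum_apply zero_fun_apply

section \<open>Smooth vector fields\<close>

lemma smooth_vfield_tangent: "smooth_vfield \<A> U X \<Longrightarrow> p \<in> U \<Longrightarrow> X p \<in> tangent_space \<A> p"
  by (auto simp: smooth_vfield_def)

lemma smooth_vfield_smooth_fun:
  "smooth_vfield \<A> U X \<Longrightarrow> open V \<Longrightarrow> V \<subseteq> U \<Longrightarrow> smooth_fun \<A> V f \<Longrightarrow> smooth_fun \<A> V (\<lambda>p. X p f)"
  by (auto simp: smooth_vfield_def)

lemma smooth_vfield_smooth_near:
  assumes "smooth_vfield \<A> U X" "open U" "p \<in> U" "smooth_near \<A> p f"
  shows "smooth_near \<A> p (\<lambda>q. X q f)"
proof -
  obtain W where W: "open W" "p \<in> W" "smooth_fun \<A> W f"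
    using assms(4) by (auto simp: smooth_near_def)
  have "smooth_fun \<A> (W \<inter> U) (\<lambda>q. X q f)"
    by (rule smooth_vfield_smooth_fun[OF assms(1)]) (use W assms smooth_fun_subset[OF _ W(3)] in auto)
  then show ?thesis
    using W assms by (intro smooth_nearI[of "W \<inter> U"]) auto
qed

lemma smooth_vfield_subset: "smooth_vfield \<A> U X \<Longrightarrow> U' \<subseteq> U \<Longrightarrow> smooth_vfield \<A> U' X"
  by (auto simp: smooth_vfield_def)

lemma smooth_vfield_cong:
  assumes "smooth_atlas \<A>" "\<And>q. q \<in> U \<Longrightarrow> X q = Y q" "smooth_vfield \<A> U X"
  shows "smooth_vfield \<A> U Y"
  unfolding smooth_vfield_def
proof (intro conjI allI impI)
  fix V f assume *: "open V \<and> V \<subseteq> U \<and> smooth_fun \<A> V f"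
  show "smooth_fun \<A> V (\<lambda>p. Y p f)"
    by (rule smooth_fun_cong[OF assms(1) _ _ smooth_vfield_smooth_fun[OF assms(3)]])
       (use * assms(2) in auto)
qed (use assms smooth_vfield_tangent in metis)

lemma smooth_vfield_add:
  assumes "smooth_atlas \<A>" "smooth_vfield \<A> U X" "smooth_vfield \<A> U Y"
  shows "smooth_vfield \<A> U (\<lambda>q. X q + Y q)"
  using assms unfolding smooth_vfield_def
  by (auto intro: smooth_fun_add subspace_add[OF subspace_tangent_space])

lemma smooth_vfield_diff:
  assumes "smooth_atlas \<A>" "smooth_vfield \<A> U X" "smooth_vfield \<A> U Y"
  shows "smooth_vfield \<A> U (\<lambda>q. X q - Y q)"
  using assms unfolding smooth_vfield_def
  by (auto intro: smooth_fun_diff subspace_diff[OF subspace_tangent_space])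

lemma smooth_vfield_scale:
  assumes "smooth_atlas \<A>" "smooth_vfield \<A> U X" "smooth_fun \<A> U c"
  shows "smooth_vfield \<A> U (\<lambda>q. c q *\<^sub>R X q)"
  unfolding smooth_vfield_def
proof (intro conjI ballI allI impI)
  fix V f assume *: "open V \<and> V \<subseteq> U \<and> smooth_fun \<A> V f"
  show "smooth_fun \<A> V (\<lambda>p. (c p *\<^sub>R X p) f)"
    unfolding scaleR_fun_def real_scaleR_def
    using * by (intro smooth_fun_mult[OF assms(1)] smooth_vfield_smooth_fun[OF assms(2)])
      (auto intro: smooth_fun_subset[OF _ assms(3)])
qed (rule subspace_scale[OF subspace_tangent_space smooth_vfield_tangent[OF assms(2)]])

lemma smooth_vfield_zero: "smooth_vfield \<A> U (\<lambda>q. 0)"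
  unfolding smooth_vfield_def
  by (auto intro: smooth_fun_const subspace_0[OF subspace_tangent_space])

lemma smooth_vfield_sum:
  assumes "smooth_atlas \<A>" "\<And>i. i \<in> I \<Longrightarrow> smooth_vfield \<A> U (X i)"
  shows "smooth_vfield \<A> U (\<lambda>q. \<Sum>i\<in>I. X i q)"
  using assms(2)
  by (induction I rule: infinite_finite_induct)
     (auto intro: smooth_vfield_zero smooth_vfield_add[OF assms(1)])

section \<open>Lie brackets\<close>

lemma lie_bracket_apply:
  "smooth_near \<A> p f \<Longrightarrow> lie_bracket \<A> X Y p f = X p (\<lambda>q. Y q f) - Y p (\<lambda>q. X q f)"
  by (simp add: lie_bracket_def)

lemma tv_comp_add:
  assumes "smooth_atlas \<A>" "open U" "p \<in> U" "v \<in> tangent_space \<A> p" "smooth_vfield \<A> U Y"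
    and "smooth_near \<A> p f" "smooth_near \<A> p h"
  shows "v (\<lambda>q. Y q (\<lambda>r. f r + h r)) = v (\<lambda>q. Y q f) + v (\<lambda>q. Y q h)"
proof -
  obtain W where W: "open W" "p \<in> W" "smooth_fun \<A> W f" "smooth_fun \<A> W h"
    using smooth_near_obtain2[OF assms(6,7)] .
  note n = smooth_vfield_smooth_near[OF assms(5,2,3)]
  have "v (\<lambda>q. Y q (\<lambda>r. f r + h r)) = v (\<lambda>q. Y q f + Y q h)"
    by (rule tv_cong[OF assms(4,1) _ open_Int[OF W(1) assms(2)]])
       (use W assms n smooth_near_add[OF assms(1,6,7)] smooth_vfield_tangent[OF assms(5)]
         in \<open>auto intro!: tv_add smooth_nearI[of W]\<close>)
  then show ?thesis
    using tv_add[OF assms(4) n[OF assms(6)] n[OF assms(7)]] by simp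
qed

text \<open>The two middle terms are symmetric in \<open>v\<close> and \<open>Y p\<close>. They
  cancel in a commutator, which makes the bracket a derivation, and they coincide when
  \<open>v\<close> is \<open>Y p\<close>, which produces \<Gamma> in
  \<open>Gam_frame\<close>.\<close>

lemma tv_comp_mult:
  assumes "smooth_atlas \<A>" "open U" "p \<in> U" "v \<in> tangent_space \<A> p" "smooth_vfield \<A> U Y"
    and "smooth_near \<A> p f" "smooth_near \<A> p h"
  shows "v (\<lambda>q. Y q (\<lambda>r. f r * h r)) =
     v (\<lambda>q. Y q f) * h p + Y p f * v h + v f * Y p h + f p * v (\<lambda>q. Y q h)"
proof -
  obtain W where W: "open W" "p \<in> W" "smooth_fun \<A> W f" "smooth_fun \<A> W h"
    using smooth_near_obtain2[OF assms(6,7)] .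
  note n = smooth_vfield_smooth_near[OF assms(5,2,3)]
  have "v (\<lambda>q. Y q (\<lambda>r. f r * h r)) = v (\<lambda>q. Y q f * h q + f q * Y q h)"
    by (rule tv_cong[OF assms(4,1) _ open_Int[OF W(1) assms(2)]])
       (use W assms n smooth_near_mult[OF assms(1,6,7)] smooth_vfield_tangent[OF assms(5)]
         in \<open>auto intro!: tv_mult smooth_nearI[of W]\<close>)
  then show ?thesis
    using assms n by (simp add: tv_add[OF assms(4)] tv_mult[OF assms(4)] smooth_near_mult)
qed

lemma lie_bracket_tangent:
  assumes "smooth_atlas \<A>" "open U" "p \<in> U" "smooth_vfield \<A> U X" "smooth_vfield \<A> U Y"
  shows "lie_bracket \<A> X Y p \<in> tangent_space \<A> p"
proof -
  note X = smooth_vfield_tangent[OF assms(4,3)] and Y = smooth_vfield_tangent[OF assms(5,3)]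
  note nX = smooth_vfield_smooth_near[OF assms(4,2,3)] and nY = smooth_vfield_smooth_near[OF assms(5,2,3)]
  let ?B = "lie_bracket \<A> X Y p"
  have 1: "?B (f + h) = ?B f + ?B h" if "smooth_near \<A> p f" "smooth_near \<A> p h" for f h
    using that smooth_near_add[OF assms(1) that]
      tv_comp_add[OF assms(1-3) X assms(5) that] tv_comp_add[OF assms(1-3) Y assms(4) that]
    by (simp add: lie_bracket_apply plus_fun_def)
  have 2: "?B (f * h) = ?B f * h p + f p * ?B h" if "smooth_near \<A> p f" "smooth_near \<A> p h" for f h
    using that smooth_near_mult[OF assms(1) that]
      tv_comp_mult[OF assms(1-3) X assms(5) that] tv_comp_mult[OF assms(1-3) Y assms(4) that]
    by (simp add: lie_bracket_apply times_fun_def algebra_simps)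
  \<comment> \<open>A field sends a constant to a function that vanishes on \<open>U\<close> but is
    arbitrary elsewhere, so the outer derivative has to be handled through germs.\<close>
  have z: "?B (\<lambda>_. c) = 0" for c
    using tv_const[OF X] tv_const[OF Y]
      tv_cong[OF X assms(1) nY[OF smooth_near_const] assms(2,3), of c "\<lambda>_. 0"]
      tv_cong[OF Y assms(1) nX[OF smooth_near_const] assms(2,3), of c "\<lambda>_. 0"]
      tv_const[OF smooth_vfield_tangent[OF assms(4)]] tv_const[OF smooth_vfield_tangent[OF assms(5)]]
    by (simp add: lie_bracket_apply smooth_near_const)
  have 3: "?B (c *\<^sub>R f) = c * ?B f" if "smooth_near \<A> p f" for c f
    using 2[OF smooth_near_const that, of c] z by (simp add: scaleR_fun_def times_fun_def)
  have 4: "?B f = ?B h" if f: "smooth_near \<A> p f" and h: "smooth_near \<A> p h" and e: "\<forall>\<^sub>F q in nhds p. f q = h q" for f h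
  proof -
    obtain W0 where W0: "open W0" "p \<in> W0" "\<And>q. q \<in> W0 \<Longrightarrow> f q = h q"
      using e by (auto simp: eventually_nhds)
    obtain W1 where W1: "open W1" "p \<in> W1" "smooth_fun \<A> W1 f" "smooth_fun \<A> W1 h"
      using smooth_near_obtain2[OF f h] .
    define W where "W = W0 \<inter> W1 \<inter> U"
    have W: "open W" "p \<in> W" unfolding W_def using W0 W1 assms by auto
    have nW: "smooth_near \<A> q f" if "q \<in> W" for q
      using that W1 by (auto simp: W_def intro: smooth_nearI[of W1])
    \<comment> \<open>The outer derivative at \<open>p\<close> sees a whole neighbourhood, so the
      inner derivatives must agree at all nearby points and not only at \<open>p\<close>.\<close>
    have ev: "X q f = X q h" "Y q f = Y q h" if "q \<in> W" for q
      by (rule tv_cong[OF _ assms(1) nW[OF that] W(1) that];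
          use that W0 smooth_vfield_tangent[OF assms(4)] smooth_vfield_tangent[OF assms(5)] in
          \<open>auto simp: W_def\<close>)+
    have "X p (\<lambda>q. Y q f) = X p (\<lambda>q. Y q h)"
      by (rule tv_cong[OF X assms(1) nY[OF f] W ev(2)])
    moreover have "Y p (\<lambda>q. X q f) = Y p (\<lambda>q. X q h)"
      by (rule tv_cong[OF Y assms(1) nX[OF f] W ev(1)])
    ultimately show ?thesis
      using f h by (simp add: lie_bracket_apply)
  qed
  show ?thesis
    unfolding tangent_space_def
    by (intro CollectI conjI allI impI; (elim conjE)?)
       (fact 1 2 3 4 | simp add: lie_bracket_def)+
qed

lemma smooth_vfield_lie_bracket:
  assumes "smooth_atlas \<A>" "open U" "smooth_vfield \<A> U X" "smooth_vfield \<A> U Y"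
  shows "smooth_vfield \<A> U (lie_bracket \<A> X Y)"
  unfolding smooth_vfield_def
proof (intro conjI ballI allI impI)
  fix V f assume *: "open V \<and> V \<subseteq> U \<and> smooth_fun \<A> V f"
  show "smooth_fun \<A> V (\<lambda>p. lie_bracket \<A> X Y p f)"
  proof (rule smooth_fun_cong[OF assms(1)])
    show "smooth_fun \<A> V (\<lambda>p. X p (\<lambda>q. Y q f) - Y p (\<lambda>q. X q f))"
      using * by (intro smooth_fun_diff[OF assms(1)] smooth_vfield_smooth_fun[OF assms(3)]
          smooth_vfield_smooth_fun[OF assms(4)]) auto
  qed (use * in \<open>auto simp: lie_bracket_apply[OF smooth_nearI]\<close>)
qed (rule lie_bracket_tangent[OF assms(1,2) _ assms(3,4)])

lemma lie_bracket_cong: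
  assumes "smooth_atlas \<A>" "open U" "p \<in> U" "smooth_vfield \<A> U X" "smooth_vfield \<A> U Y"
    and "\<And>q. q \<in> U \<Longrightarrow> X' q = X q" "\<And>q. q \<in> U \<Longrightarrow> Y' q = Y q"
  shows "lie_bracket \<A> X' Y' p = lie_bracket \<A> X Y p"
proof
  fix f
  note X = smooth_vfield_tangent[OF assms(4,3)] and Y = smooth_vfield_tangent[OF assms(5,3)]
  note nX = smooth_vfield_smooth_near[OF assms(4,2,3)] and nY = smooth_vfield_smooth_near[OF assms(5,2,3)]
  show "lie_bracket \<A> X' Y' p f = lie_bracket \<A> X Y p f"
  proof (cases "smooth_near \<A> p f")
    case True
    have "X p (\<lambda>q. Y q f) = X p (\<lambda>q. Y' q f)"
      by (rule tv_cong[OF X assms(1) nY[OF True] assms(2,3)]) (simp add: assms(7))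
    moreover have "Y p (\<lambda>q. X q f) = Y p (\<lambda>q. X' q f)"
      by (rule tv_cong[OF Y assms(1) nX[OF True] assms(2,3)]) (simp add: assms(6))
    ultimately show ?thesis
      using True assms by (simp add: lie_bracket_apply)
  qed (simp add: lie_bracket_def)
qed

lemma lie_bracket_scale_left:
  assumes "smooth_atlas \<A>" "open U" "p \<in> U" "smooth_vfield \<A> U X" "smooth_vfield \<A> U Y"
    and "smooth_fun \<A> U c"
  shows "lie_bracket \<A> (\<lambda>q. c q *\<^sub>R X q) Y p = c p *\<^sub>R lie_bracket \<A> X Y p - Y p c *\<^sub>R X p"
proof
  fix f
  note X = smooth_vfield_tangent[OF assms(4,3)] and Y = smooth_vfield_tangent[OF assms(5,3)]
  note nX = smooth_vfield_smooth_near[OF assms(4,2,3)]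
  show "lie_bracket \<A> (\<lambda>q. c q *\<^sub>R X q) Y p f = (c p *\<^sub>R lie_bracket \<A> X Y p - Y p c *\<^sub>R X p) f"
  proof (cases "smooth_near \<A> p f")
    case True
    then show ?thesis
      using tv_mult[OF Y smooth_nearI[OF assms(2,3,6)] nX[OF True]]
      by (simp add: lie_bracket_apply scaleR_fun_def[of _ "X _"] scaleR_fun_def[of _ "lie_bracket _ _ _ _"]
         algebra_simps)
  \<comment> \<open>On functions not smooth near \<open>p\<close> both sides vanish: the bracket by
    its default value, \<open>X p\<close> as a tangent vector.\<close>
  qed (use tv_not_smooth[OF X] in \<open>simp add: lie_bracket_def scaleR_fun_def\<close>)
qed

lemma lie_bracket_antisym: "lie_bracket \<A> X Y p = - lie_bracket \<A> Y X p"
  by (rule ext) (simp add: lie_bracket_def)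

lemma lie_bracket_sum_left:
  assumes "smooth_atlas \<A>" "open U" "p \<in> U" "\<And>i. i \<in> I \<Longrightarrow> smooth_vfield \<A> U (X i)" "smooth_vfield \<A> U Y"
  shows "lie_bracket \<A> (\<lambda>q. \<Sum>i\<in>I. X i q) Y p = (\<Sum>i\<in>I. lie_bracket \<A> (X i) Y p)"
proof
  fix f
  note Y = smooth_vfield_tangent[OF assms(5,3)]
  note nX = smooth_vfield_smooth_near[OF assms(4) assms(2,3)]
  show "lie_bracket \<A> (\<lambda>q. \<Sum>i\<in>I. X i q) Y p f = (\<Sum>i\<in>I. lie_bracket \<A> (X i) Y p) f"
  proof (cases "smooth_near \<A> p f")
    case True
    then show ?thesis
      using tv_sum[OF Y nX assms(1), of I "\<lambda>i. i"]
      by (simp add: lie_bracket_apply tvec_sum_apply sum_subtractf)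
  qed (simp add: lie_bracket_def tvec_sum_apply)
qed

section \<open>Traces, connections and curvature in an orthonormal frame\<close>

lemma lin_on_sum:
  assumes "lin_on S A" "subspace S" "\<And>i. i \<in> I \<Longrightarrow> v i \<in> S"
  shows "A (\<Sum>i\<in>I. c i *\<^sub>R v i) = (\<Sum>i\<in>I. c i *\<^sub>R A (v i))"
proof -
  have A: "A (a *\<^sub>R u + b *\<^sub>R w) = a *\<^sub>R A u + b *\<^sub>R A w" if "u \<in> S" "w \<in> S" for a b u w
    using assms(1) that by (auto simp: lin_on_def)
  have A0: "A 0 = 0"
    using A[OF subspace_0[OF assms(2)] subspace_0[OF assms(2)], of 0 0] by simp
  show ?thesis
    using assms(3)
  proof (induction I rule: infinite_finite_induct)
    case (insert i I)
    have "(\<Sum>i\<in>I. c i *\<^sub>R v i) \<in> S"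
      using insert.prems by (intro subspace_sum[OF assms(2)] subspace_scale[OF assms(2)]) auto
    then show ?case
      using insert A[of "v i" "\<Sum>i\<in>I. c i *\<^sub>R v i" "c i" 1] by simp
  qed (simp_all add: A0)
qed

text \<open>The double sum of \<open>representation B (e i) b * G (A b) (e i)\<close> collapses to
  one trace or the other according to which index is summed first: over \<open>b\<close> it expands
  \<open>e i\<close> in the chosen basis, over \<open>i\<close> it expands \<open>A b\<close> in the
  frame. In the applications \<open>G\<close> is the metric at a point.\<close>

lemma trace_on_orthonormal:
  assumes "finite I" "subspace S" "\<And>i. i \<in> I \<Longrightarrow> e i \<in> S"
    and expand: "\<And>v. v \<in> S \<Longrightarrow> v = (\<Sum>i\<in>I. G v (e i) *\<^sub>R e i)"
    and A: "lin_on S A" "\<And>v. v \<in> S \<Longrightarrow> A v \<in> S"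
    and G: "\<And>w. w \<in> S \<Longrightarrow> lin_on S (\<lambda>v. G v w)"
  shows "trace_on S A = (\<Sum>i\<in>I. G (A (e i)) (e i))"
proof -
  define B where "B = (SOME B. independent B \<and> span B = S)"
  have "\<exists>B. independent B \<and> span B = S"
    using basis_exists[of S] span_minimal[OF _ assms(2)] by (metis subset_antisym)
  then have B: "independent B" "span B = S"
    unfolding B_def by (metis (mono_tags, lifting) someI_ex)+
  have "S \<subseteq> span (e ` I)"
  proof
    fix v assume "v \<in> S"
    then show "v \<in> span (e ` I)"
      using expand[of v] by (metis (no_types, lifting) span_sum span_scale span_base imageI)
  qed
  then have fB: "finite B"
    using independent_span_bound[of "e ` I" B] B span_superset assms(1) by blast
  have BS: "b \<in> S" if "b \<in> B" for b
    using B that span_base by blast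
  have "G (A (e i)) (e i) = (\<Sum>b\<in>B. representation B (e i) b * G (A b) (e i))" if "i \<in> I" for i
  proof -
    have "e i = (\<Sum>b\<in>B. representation B (e i) b *\<^sub>R b)"
      using sum_representation_eq[OF B(1) _ fB subset_refl, of "e i"] B assms(3) that by simp
    then have "A (e i) = (\<Sum>b\<in>B. representation B (e i) b *\<^sub>R A b)"
      using lin_on_sum[OF A(1) assms(2) BS, of B "\<lambda>b. b" "representation B (e i)"] by metis
    then show ?thesis
      using lin_on_sum[OF G[OF assms(3)[OF that]] assms(2) A(2)[OF BS], of B "\<lambda>b. b"] by simp
  qed
  then have "(\<Sum>i\<in>I. G (A (e i)) (e i)) = (\<Sum>b\<in>B. \<Sum>i\<in>I. representation B (e i) b * G (A b) (e i))"
    by (simp add: sum.swap[of _ B])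
  also have "\<dots> = (\<Sum>b\<in>B. representation B (A b) b)"
  proof (rule sum.cong[OF refl])
    fix b assume b: "b \<in> B"
    have "representation B (A b) b = representation B (\<Sum>i\<in>I. G (A b) (e i) *\<^sub>R e i) b"
      using expand[OF A(2)[OF BS[OF b]]] by simp
    also have "\<dots> = (\<Sum>i\<in>I. representation B (G (A b) (e i) *\<^sub>R e i) b)"
      by (subst representation_sum) (use B assms(3) subspace_scale[OF assms(2)] in auto)
    also have "\<dots> = (\<Sum>i\<in>I. representation B (e i) b * G (A b) (e i))"
      by (intro sum.cong refl) (use B assms(3) in \<open>auto simp: representation_scale\<close>)
    finally show "(\<Sum>i\<in>I. representation B (e i) b * G (A b) (e i)) = representation B (A b) b" by simp
  qed
  finally show ?thesis
    unfolding trace_on_def Let_def B_def[symmetric] by simp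
qed

subsection \<open>Linear connections\<close>

lemma conn_smooth:
  assumes "linear_connection \<A> D" "open U" "smooth_vfield \<A> U X" "smooth_vfield \<A> U Y"
  shows "smooth_vfield \<A> U (D X Y)"
  using assms unfolding linear_connection_def by blast

lemma conn_tangent:
  assumes "linear_connection \<A> D" "open U" "smooth_vfield \<A> U X" "smooth_vfield \<A> U Y" "p \<in> U"
  shows "D X Y p \<in> tangent_space \<A> p"
  using smooth_vfield_tangent[OF conn_smooth[OF assms(1-4)] assms(5)] .

lemma conn_cong:
  assumes "linear_connection \<A> D" "open U" "smooth_vfield \<A> U X" "smooth_vfield \<A> U Y" "p \<in> U"
    and "\<And>q. q \<in> U \<Longrightarrow> X' q = X q" "\<And>q. q \<in> U \<Longrightarrow> Y' q = Y q"
  shows "D X' Y' p = D X Y p"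
proof -
  have "(\<forall>q\<in>U. X' q = X q \<and> Y' q = Y q) \<longrightarrow> (\<forall>p\<in>U. D X' Y' p = D X Y p)"
    using assms(1)[unfolded linear_connection_def, rule_format, OF conjI[OF assms(2) conjI[OF assms(3,4)]]]
    by meson
  then show ?thesis using assms(5-7) by blast
qed

lemma conn_add_left:
  assumes "linear_connection \<A> D" "open U" "p \<in> U"
    and "smooth_vfield \<A> U X" "smooth_vfield \<A> U W" "smooth_vfield \<A> U Y"
  shows "D (\<lambda>q. X q + W q) Y p = D X Y p + D W Y p"
  using assms(1)[unfolded linear_connection_def, rule_format, OF conjI[OF assms(2) conjI[OF assms(4,6)]]]
    assms(3,5) unfolding plus_fun_def by meson

lemma conn_add_right:
  assumes "linear_connection \<A> D" "open U" "p \<in> U"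
    and "smooth_vfield \<A> U X" "smooth_vfield \<A> U Y" "smooth_vfield \<A> U W"
  shows "D X (\<lambda>q. Y q + W q) p = D X Y p + D X W p"
  using assms(1)[unfolded linear_connection_def, rule_format, OF conjI[OF assms(2) conjI[OF assms(4,5)]]]
    assms(3,6) unfolding plus_fun_def by meson

lemma conn_scale_left:
  assumes "linear_connection \<A> D" "open U" "p \<in> U"
    and "smooth_vfield \<A> U X" "smooth_vfield \<A> U Y" "smooth_fun \<A> U c"
  shows "D (\<lambda>q. c q *\<^sub>R X q) Y p = c p *\<^sub>R D X Y p"
  using assms(1)[unfolded linear_connection_def, rule_format, OF conjI[OF assms(2) conjI[OF assms(4,5)]]]
    assms(3,6) by meson

lemma conn_scale_right:
  assumes "linear_connection \<A> D" "open U" "p \<in> U"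
    and "smooth_vfield \<A> U X" "smooth_vfield \<A> U Y" "smooth_fun \<A> U c"
  shows "D X (\<lambda>q. c q *\<^sub>R Y q) p = c p *\<^sub>R D X Y p + X p c *\<^sub>R Y p"
  using assms(1)[unfolded linear_connection_def, rule_format, OF conjI[OF assms(2) conjI[OF assms(4,5)]]]
    assms(3,6) by meson

lemma conn_zero_left:
  assumes "linear_connection \<A> D" "open U" "p \<in> U" "smooth_vfield \<A> U Y"
  shows "D (\<lambda>q. 0) Y p = 0"
  using conn_scale_left[OF assms(1-3) smooth_vfield_zero assms(4) smooth_fun_const, of 0] by simp

lemma conn_zero_right:
  assumes "linear_connection \<A> D" "open U" "p \<in> U" "smooth_vfield \<A> U X"
  shows "D X (\<lambda>q. 0) p = 0"
  using conn_scale_right[OF assms(1-3) assms(4) smooth_vfield_zero smooth_fun_const, of 0] by simp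

lemma conn_sum_left:
  assumes "linear_connection \<A> D" "open U" "p \<in> U" "smooth_atlas \<A>"
    and "\<And>i. i \<in> I \<Longrightarrow> smooth_vfield \<A> U (X i)" "smooth_vfield \<A> U Y"
    and "\<And>i. i \<in> I \<Longrightarrow> smooth_fun \<A> U (c i)"
  shows "D (\<lambda>q. \<Sum>i\<in>I. c i q *\<^sub>R X i q) Y p = (\<Sum>i\<in>I. c i p *\<^sub>R D (X i) Y p)"
  using assms(5,7)
proof (induction I rule: infinite_finite_induct)
  case (insert i I)
  have 1: "smooth_vfield \<A> U (\<lambda>q. \<Sum>i\<in>I. c i q *\<^sub>R X i q)"
    using insert.prems by (intro smooth_vfield_sum smooth_vfield_scale assms(4)) auto
  have 2: "smooth_vfield \<A> U (\<lambda>q. c i q *\<^sub>R X i q)"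
    using insert.prems by (intro smooth_vfield_scale assms(4)) auto
  have 3: "D (\<lambda>q. \<Sum>i\<in>I. c i q *\<^sub>R X i q) Y p = (\<Sum>i\<in>I. c i p *\<^sub>R D (X i) Y p)"
    using insert by blast
  have 4: "D (\<lambda>q. c i q *\<^sub>R X i q) Y p = c i p *\<^sub>R D (X i) Y p"
    using insert.prems by (intro conn_scale_left[OF assms(1-3) _ assms(6)]) auto
  show ?case
    by (simp only: sum.insert[OF insert.hyps] conn_add_left[OF assms(1-3) 2 1 assms(6)] 3 4)
qed (use conn_zero_left[OF assms(1-3,6)] in auto)

lemma conn_sum_right:
  assumes "linear_connection \<A> D" "open U" "p \<in> U" "smooth_atlas \<A>"
    and "\<And>i. i \<in> I \<Longrightarrow> smooth_vfield \<A> U (Y i)" "smooth_vfield \<A> U X"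
    and "\<And>i. i \<in> I \<Longrightarrow> smooth_fun \<A> U (c i)"
  shows "D X (\<lambda>q. \<Sum>i\<in>I. c i q *\<^sub>R Y i q) p = (\<Sum>i\<in>I. c i p *\<^sub>R D X (Y i) p + X p (c i) *\<^sub>R Y i p)"
  using assms(5,7)
proof (induction I rule: infinite_finite_induct)
  case (insert i I)
  have 1: "smooth_vfield \<A> U (\<lambda>q. \<Sum>i\<in>I. c i q *\<^sub>R Y i q)"
    using insert.prems by (intro smooth_vfield_sum smooth_vfield_scale assms(4)) auto
  have 2: "smooth_vfield \<A> U (\<lambda>q. c i q *\<^sub>R Y i q)"
    using insert.prems by (intro smooth_vfield_scale assms(4)) auto
  have 3: "D X (\<lambda>q. \<Sum>i\<in>I. c i q *\<^sub>R Y i q) p = (\<Sum>i\<in>I. c i p *\<^sub>R D X (Y i) p + X p (c i) *\<^sub>R Y i p)"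
    using insert by blast
  have 4: "D X (\<lambda>q. c i q *\<^sub>R Y i q) p = c i p *\<^sub>R D X (Y i) p + X p (c i) *\<^sub>R Y i p"
    using insert.prems by (intro conn_scale_right[OF assms(1-3) assms(6)]) auto
  show ?case
    by (simp only: sum.insert[OF insert.hyps] conn_add_right[OF assms(1-3) assms(6) 2 1] 3 4)
qed (use conn_zero_right[OF assms(1-3,6)] in auto)

subsection \<open>Orthonormal frames\<close>

locale riemannian =
  fixes \<A> :: "('m::topological_space, 'e::euclidean_space) atlas"
    and g :: "'m \<Rightarrow> 'm tvec \<Rightarrow> 'm tvec \<Rightarrow> real"
  assumes metric: "riemannian_metric \<A> g"
begin

lemma g_commute: "u \<in> tangent_space \<A> p \<Longrightarrow> v \<in> tangent_space \<A> p \<Longrightarrow> g p u v = g p v u"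
  using metric by (auto simp: riemannian_metric_def)

lemma g_lin: "u \<in> tangent_space \<A> p \<Longrightarrow> lin_on (tangent_space \<A> p) (g p u)"
  using metric by (auto simp: riemannian_metric_def)

lemma g_add_right:
  assumes "u \<in> tangent_space \<A> p" "v \<in> tangent_space \<A> p" "w \<in> tangent_space \<A> p"
  shows "g p u (v + w) = g p u v + g p u w"
  using g_lin[OF assms(1), unfolded lin_on_def, rule_format, OF assms(2,3), of 1 1] by simp

lemma g_diff_right:
  assumes "u \<in> tangent_space \<A> p" "v \<in> tangent_space \<A> p" "w \<in> tangent_space \<A> p"
  shows "g p u (v - w) = g p u v - g p u w"
  using g_lin[OF assms(1), unfolded lin_on_def, rule_format, OF assms(2,3), of 1 "-1"] by simp

lemma g_scale_right:
  assumes "u \<in> tangent_space \<A> p" "v \<in> tangent_space \<A> p"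
  shows "g p u (c *\<^sub>R v) = c * g p u v"
  using g_lin[OF assms(1), unfolded lin_on_def, rule_format, OF assms(2,2), of c 0] by simp

lemma g_sum_right:
  assumes "u \<in> tangent_space \<A> p" "\<And>i. i \<in> K \<Longrightarrow> v i \<in> tangent_space \<A> p"
  shows "g p u (\<Sum>i\<in>K. c i *\<^sub>R v i) = (\<Sum>i\<in>K. c i * g p u (v i))"
  using lin_on_sum[OF g_lin[OF assms(1)] subspace_tangent_space assms(2), of K "\<lambda>i. i"] by simp

lemma tangent_intros:
  "u \<in> tangent_space \<A> p \<Longrightarrow> v \<in> tangent_space \<A> p \<Longrightarrow> u + v \<in> tangent_space \<A> p"
  "u \<in> tangent_space \<A> p \<Longrightarrow> v \<in> tangent_space \<A> p \<Longrightarrow> u - v \<in> tangent_space \<A> p"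
  "u \<in> tangent_space \<A> p \<Longrightarrow> c *\<^sub>R u \<in> tangent_space \<A> p"
  "(\<And>i. i \<in> K \<Longrightarrow> x i \<in> tangent_space \<A> p) \<Longrightarrow> (\<Sum>i\<in>K. x i) \<in> tangent_space \<A> p"
  by (rule subspace_add[OF subspace_tangent_space] subspace_diff[OF subspace_tangent_space]
      subspace_scale[OF subspace_tangent_space] subspace_sum[OF subspace_tangent_space]; assumption)+

lemma g_add_left:
  assumes "u \<in> tangent_space \<A> p" "v \<in> tangent_space \<A> p" "w \<in> tangent_space \<A> p"
  shows "g p (v + w) u = g p v u + g p w u"
  using g_add_right[OF assms] assms by (simp add: g_commute tangent_intros)

lemma g_diff_left:
  assumes "u \<in> tangent_space \<A> p" "v \<in> tangent_space \<A> p" "w \<in> tangent_space \<A> p"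
  shows "g p (v - w) u = g p v u - g p w u"
  using g_diff_right[OF assms] assms by (simp add: g_commute tangent_intros)

lemma g_scale_left:
  assumes "u \<in> tangent_space \<A> p" "v \<in> tangent_space \<A> p"
  shows "g p (c *\<^sub>R v) u = c * g p v u"
  using g_scale_right[OF assms] assms by (simp add: g_commute tangent_intros)

lemma g_sum_left:
  assumes "u \<in> tangent_space \<A> p" "\<And>i. i \<in> K \<Longrightarrow> v i \<in> tangent_space \<A> p"
  shows "g p (\<Sum>i\<in>K. c i *\<^sub>R v i) u = (\<Sum>i\<in>K. c i * g p (v i) u)"
proof -
  have "(\<Sum>i\<in>K. c i *\<^sub>R v i) \<in> tangent_space \<A> p"
    using assms(2) by (intro tangent_intros)
  then have "g p (\<Sum>i\<in>K. c i *\<^sub>R v i) u = g p u (\<Sum>i\<in>K. c i *\<^sub>R v i)"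
    using assms(1) by (rule g_commute)
  also have "\<dots> = (\<Sum>i\<in>K. c i * g p u (v i))"
    by (rule g_sum_right[OF assms])
  also have "\<dots> = (\<Sum>i\<in>K. c i * g p (v i) u)"
    by (intro sum.cong refl arg_cong[where f="(*) _"] g_commute assms)
  finally show ?thesis .
qed

end

locale orthonormal_frame = riemannian \<A> g
  for \<A> :: "('m::topological_space, 'e::euclidean_space) atlas"
    and g :: "'m \<Rightarrow> 'm tvec \<Rightarrow> 'm tvec \<Rightarrow> real" +
  fixes U :: "'m set" and e :: "'i \<Rightarrow> 'm vfield" and I :: "'i set"
  assumes atlas: "smooth_atlas \<A>"
    and open_U: "open U" and finite_I: "finite I"
    and smooth_e: "\<And>a. a \<in> I \<Longrightarrow> smooth_vfield \<A> U (e a)"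
    and orthonormal: "\<And>p a b. p \<in> U \<Longrightarrow> a \<in> I \<Longrightarrow> b \<in> I \<Longrightarrow> g p (e a p) (e b p) = (if a = b then 1 else 0)"
    and expand: "\<And>p v. p \<in> U \<Longrightarrow> v \<in> tangent_space \<A> p \<Longrightarrow> v = (\<Sum>a\<in>I. g p v (e a p) *\<^sub>R e a p)"
begin

lemma e_tangent: "p \<in> U \<Longrightarrow> a \<in> I \<Longrightarrow> e a p \<in> tangent_space \<A> p"
  using smooth_vfield_tangent smooth_e by blast

lemma eq_by_frame:
  assumes "p \<in> U" "v \<in> tangent_space \<A> p" "w \<in> tangent_space \<A> p"
    and "\<And>a. a \<in> I \<Longrightarrow> g p v (e a p) = g p w (e a p)"
  shows "v = w"
proof -
  have "(\<Sum>a\<in>I. g p v (e a p) *\<^sub>R e a p) = (\<Sum>a\<in>I. g p w (e a p) *\<^sub>R e a p)"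
    using assms(4) by (intro sum.cong) auto
  then show ?thesis
    using expand[OF assms(1,2)] expand[OF assms(1,3)] by simp
qed

lemma smooth_g:
  assumes "open W" "smooth_vfield \<A> W X" "smooth_vfield \<A> W Y"
  shows "smooth_fun \<A> W (\<lambda>p. g p (X p) (Y p))"
  using assms metric unfolding riemannian_metric_def by blast

lemma sum_frame_delta:
  fixes K :: "'i \<Rightarrow> 'v::real_vector"
  assumes "p \<in> U" "b \<in> I"
  shows "(\<Sum>a\<in>I. g p (e b p) (e a p) *\<^sub>R K a) = K b"
proof -
  have "(\<Sum>a\<in>I. g p (e b p) (e a p) *\<^sub>R K a) = (\<Sum>a\<in>I. if b = a then K a else 0)"
    using assms by (intro sum.cong) (auto simp: orthonormal)
  then show ?thesis
    using finite_I assms by simp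
qed

text \<open>Maps defined through \<open>extend\<close> are not visibly linear. The hypothesis
  \<open>F\<close> records that they depend on \<open>v\<close> through its frame coefficients, and
  linearity follows from that.\<close>

lemma trace_on_tensor:
  assumes "p \<in> U" "\<And>a. a \<in> I \<Longrightarrow> K a \<in> tangent_space \<A> p"
    and F: "\<And>v. v \<in> tangent_space \<A> p \<Longrightarrow> F v = (\<Sum>a\<in>I. g p v (e a p) *\<^sub>R K a)"
  shows "trace_on (tangent_space \<A> p) F = (\<Sum>a\<in>I. g p (K a) (e a p))"
proof -
  have "trace_on (tangent_space \<A> p) F = (\<Sum>a\<in>I. g p (F (e a p)) (e a p))"
  proof (rule trace_on_orthonormal[where G = "g p" and e = "\<lambda>a. e a p", OF finite_I subspace_tangent_space])
    show "e a p \<in> tangent_space \<A> p" if "a \<in> I" for a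
      using e_tangent[OF assms(1) that] .
    show "v = (\<Sum>a\<in>I. g p v (e a p) *\<^sub>R e a p)" if "v \<in> tangent_space \<A> p" for v
      using expand[OF assms(1) that] .
    show "lin_on (tangent_space \<A> p) F"
      unfolding lin_on_def
    proof (intro ballI allI)
      fix u v and a b :: real
      assume uv: "u \<in> tangent_space \<A> p" "v \<in> tangent_space \<A> p"
      have "g p (a *\<^sub>R u + b *\<^sub>R v) (e i p) *\<^sub>R K i
          = a *\<^sub>R g p u (e i p) *\<^sub>R K i + b *\<^sub>R g p v (e i p) *\<^sub>R K i" if "i \<in> I" for i
        using uv that assms(1)
        by (simp add: g_add_left g_scale_left e_tangent tangent_intros scaleR_add_left)
      then show "F (a *\<^sub>R u + b *\<^sub>R v) = a *\<^sub>R F u + b *\<^sub>R F v"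
        using uv by (simp add: F tangent_intros sum.distrib scaleR_sum_right)
    qed
    show "F v \<in> tangent_space \<A> p" if "v \<in> tangent_space \<A> p" for v
      unfolding F[OF that] using assms(2) by (intro tangent_intros)
    show "lin_on (tangent_space \<A> p) (\<lambda>v. g p v w)" if "w \<in> tangent_space \<A> p" for w
      using that unfolding lin_on_def by (auto simp: g_add_left g_scale_left tangent_intros)
  qed
  also have "\<dots> = (\<Sum>a\<in>I. g p (K a) (e a p))"
    using assms(1) by (intro sum.cong) (auto simp: F e_tangent sum_frame_delta)
  finally show ?thesis .
qed

text \<open>The frame combination with the constant coefficients \<open>g p v (e a p)\<close> is a
  smooth field through \<open>v\<close>, so the \<open>SOME\<close> in \<open>extend\<close> has a
  candidate. The field chosen is smooth on some neighbourhood of \<open>p\<close> only, whence the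
  intersection with \<open>U\<close>.\<close>

lemma extend_smooth:
  assumes "p \<in> U" "v \<in> tangent_space \<A> p"
  shows "\<exists>W. open W \<and> p \<in> W \<and> W \<subseteq> U \<and> smooth_vfield \<A> W (extend \<A> p v)" "extend \<A> p v p = v"
proof -
  let ?X = "\<lambda>q. \<Sum>a\<in>I. g p v (e a p) *\<^sub>R e a q"
  have "smooth_vfield \<A> U ?X"
    using smooth_e by (intro smooth_vfield_sum smooth_vfield_scale atlas smooth_fun_const)
  then have "\<exists>X. (\<exists>W. open W \<and> p \<in> W \<and> smooth_vfield \<A> W X) \<and> X p = v"
    using assms open_U expand[OF assms, symmetric] by (intro exI[of _ ?X]) auto
  from someI_ex[OF this] obtain W where
    W: "open W" "p \<in> W" "smooth_vfield \<A> W (extend \<A> p v)" and v: "extend \<A> p v p = v"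
    unfolding extend_def[symmetric] by auto
  show "extend \<A> p v p = v" by (fact v)
  show "\<exists>W. open W \<and> p \<in> W \<and> W \<subseteq> U \<and> smooth_vfield \<A> W (extend \<A> p v)"
    using W open_U assms by (intro exI[of _ "W \<inter> U"]) (auto intro: smooth_vfield_subset)
qed

text \<open>On \<open>W\<close> the field \<open>X\<close> equals its frame expansion, whose
  coefficients are smooth, and \<open>D\<close> is linear over smooth functions in the first
  argument. Hence the choice made by \<open>extend\<close> does not matter for a divergence.\<close>

lemma conn_tensorial:
  assumes "linear_connection \<A> D" "open W" "p \<in> W" "W \<subseteq> U"
    and "smooth_vfield \<A> W X" "smooth_vfield \<A> W Y"
  shows "D X Y p = (\<Sum>a\<in>I. g p (X p) (e a p) *\<^sub>R D (e a) Y p)"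
proof -
  have eW: "smooth_vfield \<A> W (e a)" if "a \<in> I" for a
    using smooth_vfield_subset[OF smooth_e[OF that] assms(4)] .
  have c: "smooth_fun \<A> W (\<lambda>q. g q (X q) (e a q))" if "a \<in> I" for a
    by (rule smooth_g[OF assms(2,5) eW[OF that]])
  have "D X Y p = D (\<lambda>q. \<Sum>a\<in>I. g q (X q) (e a q) *\<^sub>R e a q) Y p"
    by (rule conn_cong[OF assms(1,2) _ assms(6) assms(3)])
       (use assms(4) eW c in
        \<open>auto intro!: smooth_vfield_sum smooth_vfield_scale atlas expand smooth_vfield_tangent[OF assms(5)]\<close>)
  also have "\<dots> = (\<Sum>a\<in>I. g p (X p) (e a p) *\<^sub>R D (e a) Y p)"
    by (rule conn_sum_left[OF assms(1-3) atlas eW assms(6) c])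
  finally show ?thesis .
qed

lemma trace_conn:
  assumes "linear_connection \<A> D" "p \<in> U" "smooth_vfield \<A> U Y"
  shows "trace_on (tangent_space \<A> p) (\<lambda>v. D (extend \<A> p v) Y p) = (\<Sum>a\<in>I. g p (D (e a) Y p) (e a p))"
proof (rule trace_on_tensor[OF assms(2)])
  show "D (extend \<A> p v) Y p = (\<Sum>a\<in>I. g p v (e a p) *\<^sub>R D (e a) Y p)" if v: "v \<in> tangent_space \<A> p" for v
  proof -
    obtain W where W: "open W" "p \<in> W" "W \<subseteq> U" "smooth_vfield \<A> W (extend \<A> p v)"
      using extend_smooth(1)[OF assms(2) v] by blast
    show ?thesis
      using conn_tensorial[OF assms(1) W smooth_vfield_subset[OF assms(3) W(3)]]
        extend_smooth(2)[OF assms(2) v] by simp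
  qed
qed (use conn_tangent[OF assms(1) open_U smooth_e assms(3,2)] in auto)

text \<open>Derivatives of the coefficients \<open>c a\<close> along \<open>Y\<close> arise twice,
  from \<open>D Y (D X V)\<close> by the Leibniz rule and from the bracket of \<open>X\<close> and
  \<open>Y\<close>, and cancel.\<close>

lemma curvature_tensorial:
  assumes D: "linear_connection \<A> D" and W: "open W" "p \<in> W" "W \<subseteq> U"
    and X: "smooth_vfield \<A> W X" and Y: "smooth_vfield \<A> W Y" and V: "smooth_vfield \<A> W V"
  shows "curvature \<A> D X Y V p = (\<Sum>a\<in>I. g p (X p) (e a p) *\<^sub>R curvature \<A> D (e a) Y V p)"
proof -
  have eW: "smooth_vfield \<A> W (e a)" if "a \<in> I" for a
    using smooth_vfield_subset[OF smooth_e[OF that] W(3)] .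
  define c where "c a q = g q (X q) (e a q)" for a q
  have c: "smooth_fun \<A> W (c a)" if "a \<in> I" for a
    unfolding c_def by (rule smooth_g[OF W(1) X eW[OF that]])
  note DV = conn_smooth[OF D W(1) eW V]
  have sX: "smooth_vfield \<A> W (\<lambda>q. \<Sum>a\<in>I. c a q *\<^sub>R e a q)"
    using eW c by (intro smooth_vfield_sum smooth_vfield_scale atlas)
  have eqX: "X q = (\<Sum>a\<in>I. c a q *\<^sub>R e a q)" if "q \<in> W" for q
    unfolding c_def by (rule expand) (use smooth_vfield_tangent[OF X that] W(3) that in auto)
  have 1: "D X (D Y V) p = (\<Sum>a\<in>I. c a p *\<^sub>R D (e a) (D Y V) p)"
    unfolding c_def by (rule conn_tensorial[OF D W X conn_smooth[OF D W(1) Y V]])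
  have "D Y (D X V) p = D Y (\<lambda>q. \<Sum>a\<in>I. c a q *\<^sub>R D (e a) V q) p"
  proof (rule conn_cong[OF D W(1) Y _ W(2)])
    show "smooth_vfield \<A> W (\<lambda>q. \<Sum>a\<in>I. c a q *\<^sub>R D (e a) V q)"
      using DV c by (intro smooth_vfield_sum smooth_vfield_scale atlas)
    show "D X V q = (\<Sum>a\<in>I. c a q *\<^sub>R D (e a) V q)" if "q \<in> W" for q
      unfolding c_def by (rule conn_tensorial[OF D W(1) that W(3) X V])
  qed simp
  also have "\<dots> = (\<Sum>a\<in>I. c a p *\<^sub>R D Y (D (e a) V) p + Y p (c a) *\<^sub>R D (e a) V p)"
    by (rule conn_sum_right[OF D W(1,2) atlas DV Y c])
  finally have 2: "D Y (D X V) p = (\<Sum>a\<in>I. c a p *\<^sub>R D Y (D (e a) V) p + Y p (c a) *\<^sub>R D (e a) V p)" .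
  have br: "lie_bracket \<A> X Y q = (\<Sum>a\<in>I. c a q *\<^sub>R lie_bracket \<A> (e a) Y q - Y q (c a) *\<^sub>R e a q)"
    if "q \<in> W" for q
  proof -
    have "lie_bracket \<A> X Y q = lie_bracket \<A> (\<lambda>q. \<Sum>a\<in>I. c a q *\<^sub>R e a q) Y q"
      by (rule lie_bracket_cong[OF atlas W(1) that sX Y eqX]) auto
    also have "\<dots> = (\<Sum>a\<in>I. lie_bracket \<A> (\<lambda>q. c a q *\<^sub>R e a q) Y q)"
      by (rule lie_bracket_sum_left[OF atlas W(1) that _ Y]) (use eW c in \<open>auto intro: smooth_vfield_scale atlas\<close>)
    finally show ?thesis
      using lie_bracket_scale_left[OF atlas W(1) that eW Y c] by simp
  qed
  have sB: "smooth_vfield \<A> W (lie_bracket \<A> (e a) Y)" if "a \<in> I" for a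
    by (rule smooth_vfield_lie_bracket[OF atlas W(1) eW[OF that] Y])
  have sYc: "smooth_fun \<A> W (\<lambda>q. - Y q (c a))" if "a \<in> I" for a
    using smooth_fun_mult[OF atlas W(1) smooth_fun_const smooth_vfield_smooth_fun[OF Y W(1) subset_refl c[OF that]], of "-1"]
    by simp
  have s1: "smooth_vfield \<A> W (\<lambda>q. \<Sum>a\<in>I. c a q *\<^sub>R lie_bracket \<A> (e a) Y q)"
    using sB c by (intro smooth_vfield_sum smooth_vfield_scale atlas)
  have s2: "smooth_vfield \<A> W (\<lambda>q. \<Sum>a\<in>I. (- Y q (c a)) *\<^sub>R e a q)"
    using eW sYc by (intro smooth_vfield_sum smooth_vfield_scale atlas)
  have "D (lie_bracket \<A> X Y) V p =
      D (\<lambda>q. (\<Sum>a\<in>I. c a q *\<^sub>R lie_bracket \<A> (e a) Y q) + (\<Sum>a\<in>I. (- Y q (c a)) *\<^sub>R e a q)) V p"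
    by (rule conn_cong[OF D W(1) smooth_vfield_add[OF atlas s1 s2] V W(2)])
       (auto simp: br sum_subtractf sum_negf)
  also have "\<dots> = (\<Sum>a\<in>I. c a p *\<^sub>R D (lie_bracket \<A> (e a) Y) V p) + (\<Sum>a\<in>I. (- Y p (c a)) *\<^sub>R D (e a) V p)"
    by (simp only: conn_add_left[OF D W(1,2) s1 s2 V] conn_sum_left[OF D W(1,2) atlas sB V c]
       conn_sum_left[OF D W(1,2) atlas eW V sYc])
  finally have 3: "D (lie_bracket \<A> X Y) V p = \<dots>" .
  show ?thesis
    unfolding curvature_def minus_apply 1 2 3 c_def[symmetric]
    by (rule ext) (simp add: tvec_apply sum.distrib sum_subtractf sum_negf right_diff_distrib)
qed

lemma smooth_curvature:
  assumes "linear_connection \<A> D" "open W" "smooth_vfield \<A> W X" "smooth_vfield \<A> W Y" "smooth_vfield \<A> W V"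
  shows "smooth_vfield \<A> W (curvature \<A> D X Y V)"
proof -
  have "smooth_vfield \<A> W (\<lambda>q. D X (D Y V) q - D Y (D X V) q - D (lie_bracket \<A> X Y) V q)"
    using assms by (intro smooth_vfield_diff conn_smooth[OF assms(1,2)] smooth_vfield_lie_bracket atlas)
  then show ?thesis by (simp add: curvature_def fun_diff_def)
qed

lemma ricci_frame:
  assumes "linear_connection \<A> D" "p \<in> U" "smooth_vfield \<A> U Y" "smooth_vfield \<A> U V"
  shows "ricci \<A> D Y V p = (\<Sum>a\<in>I. g p (curvature \<A> D (e a) Y V p) (e a p))"
  unfolding ricci_def
proof (rule trace_on_tensor[OF assms(2)])
  show "curvature \<A> D (extend \<A> p v) Y V p = (\<Sum>a\<in>I. g p v (e a p) *\<^sub>R curvature \<A> D (e a) Y V p)"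
    if v: "v \<in> tangent_space \<A> p" for v
  proof -
    obtain W where W: "open W" "p \<in> W" "W \<subseteq> U" "smooth_vfield \<A> W (extend \<A> p v)"
      using extend_smooth(1)[OF assms(2) v] by blast
    show ?thesis
      using curvature_tensorial[OF assms(1) W smooth_vfield_subset[OF assms(3) W(3)] smooth_vfield_subset[OF assms(4) W(3)]]
        extend_smooth(2)[OF assms(2) v] by simp
  qed
qed (use smooth_vfield_tangent[OF smooth_curvature[OF assms(1) open_U smooth_e assms(3,4)] assms(2)] in auto)

section \<open>Gradient, Laplacian and Levi-Civita connection in a frame\<close>

lemma gradient_frame:
  assumes "p \<in> U"
  shows "gradient \<A> g h p = (\<Sum>a\<in>I. e a p h *\<^sub>R e a p)"
  unfolding gradient_def
proof (rule the_equality)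
  have t: "(\<Sum>a\<in>I. e a p h *\<^sub>R e a p) \<in> tangent_space \<A> p"
    using e_tangent[OF assms] by (intro tangent_intros)
  have "g p (\<Sum>a\<in>I. e a p h *\<^sub>R e a p) w = w h" if "w \<in> tangent_space \<A> p" for w
  proof -
    have "w h = (\<Sum>a\<in>I. g p w (e a p) *\<^sub>R e a p) h"
      using expand[OF assms that] by simp
    also have "\<dots> = (\<Sum>a\<in>I. e a p h * g p (e a p) w)"
      using that assms e_tangent by (auto simp: tvec_sum_apply scaleR_fun_def g_commute intro!: sum.cong)
    finally show ?thesis
      using g_sum_left[OF that e_tangent[OF assms]] by simp
  qed
  with t show "(\<Sum>a\<in>I. e a p h *\<^sub>R e a p) \<in> tangent_space \<A> p \<and>
    (\<forall>w\<in>tangent_space \<A> p. g p (\<Sum>a\<in>I. e a p h *\<^sub>R e a p) w = w h)" by blast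
  show "v = (\<Sum>a\<in>I. e a p h *\<^sub>R e a p)"
    if "v \<in> tangent_space \<A> p \<and> (\<forall>w\<in>tangent_space \<A> p. g p v w = w h)" for v
    using expand[OF assms, of v] that e_tangent[OF assms] by auto
qed

lemma smooth_gradient:
  assumes "smooth_fun \<A> U h"
  shows "smooth_vfield \<A> U (gradient \<A> g h)"
proof (rule smooth_vfield_cong[OF atlas gradient_frame[symmetric]])
  show "smooth_vfield \<A> U (\<lambda>q. \<Sum>a\<in>I. e a q h *\<^sub>R e a q)"
    using smooth_e smooth_vfield_smooth_fun[OF smooth_e open_U subset_refl assms]
    by (intro smooth_vfield_sum smooth_vfield_scale atlas)
qed

lemma g_gradient:
  assumes "p \<in> U" "w \<in> tangent_space \<A> p"
  shows "g p (gradient \<A> g h p) w = w h"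
proof -
  have "w h = (\<Sum>a\<in>I. g p w (e a p) *\<^sub>R e a p) h"
    using expand[OF assms] by simp
  also have "\<dots> = (\<Sum>a\<in>I. e a p h * g p (e a p) w)"
    using assms e_tangent by (auto simp: tvec_sum_apply scaleR_fun_def g_commute intro!: sum.cong)
  finally show ?thesis
    using g_sum_left[OF assms(2) e_tangent[OF assms(1)]] by (simp add: gradient_frame assms(1))
qed

lemma metric_conn:
  assumes "metric_connection \<A> g D" "p \<in> U" "smooth_vfield \<A> U X" "smooth_vfield \<A> U Y" "smooth_vfield \<A> U W"
  shows "X p (\<lambda>q. g q (Y q) (W q)) = g p (D X Y p) (W p) + g p (Y p) (D X W p)"
  using assms open_U unfolding metric_connection_def by blast

lemma vfield_cong:
  assumes "smooth_vfield \<A> U X" "p \<in> U" "smooth_fun \<A> U f" "\<And>q. q \<in> U \<Longrightarrow> f q = h q"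
  shows "X p f = X p h"
  by (rule tv_cong[OF smooth_vfield_tangent[OF assms(1,2)] atlas smooth_nearI[OF open_U assms(2,3)] open_U assms(2,4)])

text \<open>Serves inner products of frame fields and values of \<open>\<theta>\<close> on
  horizontal fields, which are constant on \<open>U\<close> and unspecified outside.\<close>

lemma vfield_eq_const:
  assumes "smooth_vfield \<A> U X" "p \<in> U" "\<And>q. q \<in> U \<Longrightarrow> h q = c"
  shows "X p h = 0"
  using vfield_cong[OF assms(1,2) smooth_fun_const, of c h] assms(3)
    tv_const[OF smooth_vfield_tangent[OF assms(1,2)]] by auto

text \<open>Metric compatibility, applied to the inner product of the gradient with
  \<open>e a\<close>, moves the derivative from the gradient to the frame field.\<close>

lemma laplace_beltrami_frame:
  assumes "levi_civita \<A> g LC" "p \<in> U" "smooth_fun \<A> U h"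
  shows "laplace_beltrami \<A> g LC h p = (\<Sum>a\<in>I. e a p (\<lambda>q. e a q h) - LC (e a) (e a) p h)"
proof -
  have m: "metric_connection \<A> g LC" and l: "linear_connection \<A> LC"
    using assms(1) by (auto simp: levi_civita_def metric_connection_def)
  note G = smooth_gradient[OF assms(3)]
  have "g p (LC (e a) (gradient \<A> g h) p) (e a p) = e a p (\<lambda>q. e a q h) - LC (e a) (e a) p h"
    if a: "a \<in> I" for a
  proof -
    have "e a p (\<lambda>q. e a q h) = e a p (\<lambda>q. g q (gradient \<A> g h q) (e a q))"
      by (rule vfield_cong[OF smooth_e[OF a] assms(2) smooth_vfield_smooth_fun[OF smooth_e[OF a] open_U subset_refl assms(3)]])
        (simp add: g_gradient e_tangent a)
    also have "\<dots> = g p (LC (e a) (gradient \<A> g h) p) (e a p) + LC (e a) (e a) p h"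
      using metric_conn[OF m assms(2) smooth_e[OF a] G smooth_e[OF a]]
        g_gradient[OF assms(2) conn_tangent[OF l open_U smooth_e[OF a] smooth_e[OF a] assms(2)]] by simp
    finally show ?thesis by simp
  qed
  then show ?thesis
    unfolding laplace_beltrami_def trace_conn[OF l assms(2) G] by simp
qed

text \<open>A case of Koszul's formula. Inner products of frame fields have no derivatives, so
  \<open>LC (e b) (e a)\<close> is orthogonal to \<open>e a\<close>, and absence of torsion leaves
  the bracket alone.\<close>

lemma levi_civita_diag:
  assumes "levi_civita \<A> g LC" "p \<in> U" "a \<in> I" "b \<in> I"
  shows "g p (LC (e a) (e a) p) (e b p) = - g p (e a p) (lie_bracket \<A> (e a) (e b) p)"
proof -
  have m: "metric_connection \<A> g LC" and l: "linear_connection \<A> LC"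
    using assms(1) by (auto simp: levi_civita_def metric_connection_def)
  have t: "torsion \<A> LC (e a) (e b) p = 0"
    using assms open_U smooth_e[OF assms(3)] smooth_e[OF assms(4)] unfolding levi_civita_def by blast
  note sa = smooth_e[OF assms(3)] and sb = smooth_e[OF assms(4)]
  note tg = conn_tangent[OF l open_U _ _ assms(2)]
  have "e a p (\<lambda>q. g q (e a q) (e b q)) = 0"
    by (rule vfield_eq_const[OF sa assms(2), of _ "if a = b then 1 else 0"]) (simp add: orthonormal assms)
  then have 1: "g p (LC (e a) (e a) p) (e b p) = - g p (e a p) (LC (e a) (e b) p)"
    using metric_conn[OF m assms(2) sa sa sb] by simp
  have "e b p (\<lambda>q. g q (e a q) (e a q)) = 0"
    by (rule vfield_eq_const[OF sb assms(2), of _ 1]) (simp add: orthonormal assms)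
  then have 2: "g p (e a p) (LC (e b) (e a) p) = 0"
    using metric_conn[OF m assms(2) sb sa sa] g_commute[OF tg[OF sb sa] e_tangent[OF assms(2,3)]] by simp
  have "lie_bracket \<A> (e a) (e b) p = LC (e a) (e b) p - LC (e b) (e a) p"
    using t by (simp add: torsion_def)
  then have "g p (e a p) (lie_bracket \<A> (e a) (e b) p) = g p (e a p) (LC (e a) (e b) p)"
    using 2 g_diff_right[OF e_tangent[OF assms(2,3)] tg[OF sa sb] tg[OF sb sa]] by simp
  then show ?thesis using 1 by simp
qed

end

section \<open>Horizontal frames on contact Riemannian manifolds\<close>

locale contact_frame =
  fixes \<A> :: "('m::topological_space, 'e::euclidean_space) atlas"
    and n :: nat
    and \<theta> :: "'m \<Rightarrow> 'm tvec \<Rightarrow> real"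
    and Z :: "'m vfield"
    and g :: "'m \<Rightarrow> 'm tvec \<Rightarrow> 'm tvec \<Rightarrow> real"
    and J :: "'m \<Rightarrow> 'm tvec \<Rightarrow> 'm tvec"
    and D :: "'m vfield \<Rightarrow> 'm vfield \<Rightarrow> 'm vfield"
    and U :: "'m set"
    and X :: "nat \<Rightarrow> 'm vfield"
  assumes contact: "contact_riemannian \<A> n \<theta> Z g J"
    and tanno: "tanno_connection \<A> \<theta> Z g D"
    and frame: "horizontal_frame \<A> n \<theta> g U X"
begin

abbreviation N :: "nat set" where "N \<equiv> {1..2 * n}"

abbreviation T :: "'m \<Rightarrow> 'm tvec set" where "T \<equiv> tangent_space \<A>"

abbreviation vf :: "'m vfield \<Rightarrow> bool" where "vf \<equiv> smooth_vfield \<A> U"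

abbreviation sm :: "('m \<Rightarrow> real) \<Rightarrow> bool" where "sm \<equiv> smooth_fun \<A> U"

text \<open>The horizontal frame starts at index 1; placing \<open>Z\<close> at index 0 completes it
  to an orthonormal frame of the whole tangent space, to which \<open>orthonormal_frame\<close>
  applies.\<close>

definition E :: "nat \<Rightarrow> 'm vfield" where "E i = (if i = 0 then Z else X i)"

definition hor :: "'m vfield \<Rightarrow> bool" where "hor Y \<longleftrightarrow> vf Y \<and> (\<forall>q\<in>U. \<theta> q (Y q) = 0)"

text \<open>On smooth vector fields \<open>b\<close> is \<open>d\<theta>\<close>; in the paper's notation \<open>\<gamma> i j = - b (X i) (X j)\<close>.\<close>

definition b :: "'m \<Rightarrow> 'm tvec \<Rightarrow> 'm tvec \<Rightarrow> real" where "b p u v = g p u (J p v)"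

lemma atlas': "smooth_atlas \<A>" and metric': "riemannian_metric \<A> g" and reeb: "reeb_field \<A> \<theta> Z"
  and one_form: "one_form \<A> \<theta>" and endo: "endo_tensor \<A> J"
  and g_Z: "v \<in> T p \<Longrightarrow> g p v (Z p) = \<theta> p v"
  and J_J: "v \<in> T p \<Longrightarrow> J p (J p v) = - v + \<theta> p v *\<^sub>R Z p"
  using contact by (auto simp: contact_riemannian_def contact_form_def)

lemma open_U': "open U" and X_smooth: "i \<in> N \<Longrightarrow> vf (X i)"
  and X_ortho: "p \<in> U \<Longrightarrow> i \<in> N \<Longrightarrow> j \<in> N \<Longrightarrow> g p (X i p) (X j p) = (if i = j then 1 else 0)"
  and X_span: "p \<in> U \<Longrightarrow> span ((\<lambda>i. X i p) ` N) = horizontal_space \<A> \<theta> p"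
  using frame by (auto simp: horizontal_frame_def)

lemma Z_smooth: "vf Z"
  using reeb smooth_vfield_subset[of \<A> UNIV Z U] by (simp add: reeb_field_def)

lemma theta_Z: "\<theta> p (Z p) = 1"
  using reeb by (auto simp: reeb_field_def)

lemma X_hor_space: "p \<in> U \<Longrightarrow> i \<in> N \<Longrightarrow> X i p \<in> horizontal_space \<A> \<theta> p"
  using X_span[of p] span_base[OF imageI[of i N "\<lambda>i. X i p"]] by simp

lemma theta_X: "p \<in> U \<Longrightarrow> i \<in> N \<Longrightarrow> \<theta> p (X i p) = 0"
  using X_hor_space by (auto simp: horizontal_space_def)

lemma X_T: "p \<in> U \<Longrightarrow> i \<in> N \<Longrightarrow> X i p \<in> T p"
  using X_hor_space by (auto simp: horizontal_space_def)

lemma Z_T: "p \<in> U \<Longrightarrow> Z p \<in> T p"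
  using Z_smooth smooth_vfield_tangent by blast

sublocale riemannian \<A> g
  by unfold_locales (rule metric')

text \<open>The tangent vectors reproduced by this expansion form a subspace that contains the frame
  vectors, hence their span, which is the horizontal space.\<close>

lemma horizontal_space_expand:
  assumes "p \<in> U" "v \<in> horizontal_space \<A> \<theta> p"
  shows "v = (\<Sum>i\<in>N. g p v (X i p) *\<^sub>R X i p)"
proof -
  let ?P = "{u \<in> T p. u = (\<Sum>i\<in>N. g p u (X i p) *\<^sub>R X i p)}"
  have "subspace ?P"
    unfolding subspace_def
  proof (intro conjI ballI allI)
    have "g p 0 (X i p) = 0" if "i \<in> N" for i
      using g_scale_left[OF X_T[OF assms(1) that] X_T[OF assms(1) that], of 0] by simp
    then show "0 \<in> ?P"
      using subspace_0[OF subspace_tangent_space] by simp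
  next
    fix x y assume xy: "x \<in> ?P" "y \<in> ?P"
    have "(\<Sum>i\<in>N. g p (x + y) (X i p) *\<^sub>R X i p)
        = (\<Sum>i\<in>N. g p x (X i p) *\<^sub>R X i p + g p y (X i p) *\<^sub>R X i p)"
      using xy X_T[OF assms(1)] by (intro sum.cong refl) (simp add: g_add_left scaleR_add_left)
    also have "\<dots> = x + y"
      unfolding sum.distrib using xy by (metis (mono_tags, lifting) mem_Collect_eq)
    finally show "x + y \<in> ?P"
      using xy tangent_intros(1) by auto
  next
    fix c x assume x: "x \<in> ?P"
    have "(\<Sum>i\<in>N. g p (c *\<^sub>R x) (X i p) *\<^sub>R X i p) = c *\<^sub>R (\<Sum>i\<in>N. g p x (X i p) *\<^sub>R X i p)"
      unfolding scaleR_sum_right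
      using x X_T[OF assms(1)] by (intro sum.cong refl) (simp add: g_scale_left)
    also have "\<dots> = c *\<^sub>R x"
      using x by (metis (mono_tags, lifting) mem_Collect_eq)
    finally show "c *\<^sub>R x \<in> ?P"
      using x tangent_intros(3) by auto
  qed
  moreover have "X j p \<in> ?P" if j: "j \<in> N" for j
  proof -
    have "(\<Sum>i\<in>N. g p (X j p) (X i p) *\<^sub>R X i p) = (\<Sum>i\<in>N. if j = i then X i p else 0)"
      using X_ortho[OF assms(1) j] by (intro sum.cong) auto
    also have "\<dots> = X j p"
      using j by (subst sum.delta') auto
    finally show ?thesis
      using X_T[OF assms(1) j] by auto
  qed
  ultimately have "span ((\<lambda>i. X i p) ` N) \<subseteq> ?P"
    by (intro span_minimal) auto
  then show ?thesis
    using assms(2) X_span[OF assms(1)] by blast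
qed

lemma theta_lin: "lin_on (T p) (\<theta> p)"
  using one_form by (auto simp: one_form_def)

lemma theta_add: "u \<in> T p \<Longrightarrow> v \<in> T p \<Longrightarrow> \<theta> p (u + v) = \<theta> p u + \<theta> p v"
  using theta_lin[unfolded lin_on_def, rule_format, of u p v 1 1] by simp

lemma theta_diff: "u \<in> T p \<Longrightarrow> v \<in> T p \<Longrightarrow> \<theta> p (u - v) = \<theta> p u - \<theta> p v"
  using theta_lin[unfolded lin_on_def, rule_format, of u p v 1 "-1"] by simp

lemma theta_scale: "u \<in> T p \<Longrightarrow> \<theta> p (c *\<^sub>R u) = c * \<theta> p u"
  using theta_lin[unfolded lin_on_def, rule_format, of u p u c 0] by simp

lemma theta_sum:
  "(\<And>i. i \<in> K \<Longrightarrow> v i \<in> T p) \<Longrightarrow> \<theta> p (\<Sum>i\<in>K. c i *\<^sub>R v i) = (\<Sum>i\<in>K. c i * \<theta> p (v i))"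
  using lin_on_sum[OF theta_lin subspace_tangent_space, of K v p c] by simp

text \<open>Subtracting the \<open>Z\<close>-part leaves a horizontal vector, and the remaining
  coefficients are unchanged because \<open>Z\<close> is orthogonal to each
  \<open>X i\<close>.\<close>

lemma frame_expand:
  assumes "p \<in> U" "v \<in> T p"
  shows "v = \<theta> p v *\<^sub>R Z p + (\<Sum>i\<in>N. g p v (X i p) *\<^sub>R X i p)"
proof -
  let ?u = "v - \<theta> p v *\<^sub>R Z p"
  have u: "?u \<in> horizontal_space \<A> \<theta> p"
    unfolding horizontal_space_def
    using assms Z_T by (simp add: tangent_intros theta_diff theta_scale theta_Z)
  have "g p ?u (X i p) = g p v (X i p)" if "i \<in> N" for i
    using assms Z_T[OF assms(1)] X_T[OF assms(1) that]
    by (simp add: g_diff_left g_scale_left tangent_intros g_commute[of "Z p"] g_Z theta_X[OF assms(1) that])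
  then have "?u = (\<Sum>i\<in>N. g p v (X i p) *\<^sub>R X i p)"
    using horizontal_space_expand[OF assms(1) u] by simp
  then show ?thesis by (simp add: algebra_simps)
qed

sublocale orthonormal_frame \<A> g U E "insert 0 N"
proof unfold_locales
  show "g p (E i p) (E j p) = (if i = j then 1 else 0)" if "p \<in> U" "i \<in> insert 0 N" "j \<in> insert 0 N" for p i j
    using that X_ortho theta_X theta_Z g_Z X_T Z_T g_commute[of "Z p" p] by (auto simp: E_def)
  show "v = (\<Sum>a\<in>insert 0 N. g p v (E a p) *\<^sub>R E a p)" if "p \<in> U" "v \<in> T p" for p v
  proof -
    have "(\<Sum>a\<in>insert 0 N. g p v (E a p) *\<^sub>R E a p) = \<theta> p v *\<^sub>R Z p + (\<Sum>i\<in>N. g p v (X i p) *\<^sub>R X i p)"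
      by (subst sum.insert) (auto simp: E_def g_Z that intro!: arg_cong2[where f = "(+)"] sum.cong)
    then show ?thesis using frame_expand[OF that] by simp
  qed
qed (use atlas' open_U' X_smooth Z_smooth in \<open>auto simp: E_def\<close>)

lemma sum_E: "(\<Sum>a\<in>insert 0 N. F (E a)) = F Z + (\<Sum>i\<in>N. F (X i))"
  by (subst sum.insert) (auto simp: E_def intro!: arg_cong2[where f = "(+)"] sum.cong)

section \<open>Tanno's connection on horizontal fields\<close>

lemma D_linear: "linear_connection \<A> D" and D_metric: "metric_connection \<A> g D"
  using tanno by (auto simp: tanno_connection_def metric_connection_def)

lemma vf_T: "vf Y \<Longrightarrow> p \<in> U \<Longrightarrow> Y p \<in> T p"
  using smooth_vfield_tangent by blast

lemma vf_D: "vf Y \<Longrightarrow> vf W \<Longrightarrow> vf (D Y W)"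
  using conn_smooth[OF D_linear open_U] .

lemma vf_bracket: "vf Y \<Longrightarrow> vf W \<Longrightarrow> vf (lie_bracket \<A> Y W)"
  using smooth_vfield_lie_bracket[OF atlas open_U] .

lemma sm_vf: "vf Y \<Longrightarrow> sm h \<Longrightarrow> sm (\<lambda>q. Y q h)"
  using smooth_vfield_smooth_fun[OF _ open_U subset_refl] .

lemma near: "p \<in> U \<Longrightarrow> sm h \<Longrightarrow> smooth_near \<A> p h"
  using smooth_nearI[OF open_U] .

lemma hor_vf: "hor Y \<Longrightarrow> vf Y" and hor_theta: "hor Y \<Longrightarrow> p \<in> U \<Longrightarrow> \<theta> p (Y p) = 0"
  by (auto simp: hor_def)

lemma hor_X: "i \<in> N \<Longrightarrow> hor (X i)"
  by (auto simp: hor_def X_smooth theta_X)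

lemma D_theta: "vf Y \<Longrightarrow> vf W \<Longrightarrow> p \<in> U \<Longrightarrow> \<theta> p (D Y W p) = Y p (\<lambda>q. \<theta> q (W q))"
  using tanno[unfolded tanno_connection_def, THEN conjunct2, THEN conjunct1, rule_format, of U Y W p] open_U
  by simp

lemma D_Z: "vf Y \<Longrightarrow> p \<in> U \<Longrightarrow> D Y Z p = 0"
  using tanno[unfolded tanno_connection_def, THEN conjunct2, THEN conjunct1, rule_format, of U Y Y p] open_U
  by simp

text \<open>As \<open>\<theta>\<close> is parallel, its value on \<open>D Y W\<close> is the
  derivative of the zero function. This keeps all iterated derivatives of the horizontal gradient
  horizontal.\<close>

lemma hor_D: assumes "vf Y" "hor W" shows "hor (D Y W)"
  unfolding hor_def
proof (intro conjI ballI)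
  show "vf (D Y W)" using assms vf_D hor_vf by blast
  show "\<theta> q (D Y W q) = 0" if "q \<in> U" for q
    unfolding D_theta[OF assms(1) hor_vf[OF assms(2)] that]
    by (rule vfield_eq_const[OF assms(1) that]) (rule hor_theta[OF assms(2)])
qed

lemma hor_expand:
  assumes "p \<in> U" "v \<in> T p" "\<theta> p v = 0"
  shows "v = (\<Sum>i\<in>N. g p v (X i p) *\<^sub>R X i p)"
  using horizontal_space_expand[OF assms(1)] assms(2,3) by (auto simp: horizontal_space_def)

lemma hor_apply:
  assumes "p \<in> U" "v \<in> T p" "\<theta> p v = 0"
  shows "v h = (\<Sum>i\<in>N. g p v (X i p) * X i p h)"
proof -
  have "v h = (\<Sum>i\<in>N. g p v (X i p) *\<^sub>R X i p) h"
    using hor_expand[OF assms] by simp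
  then show ?thesis by (simp add: tvec_sum_apply scaleR_fun_def)
qed

lemma g_sum_X:
  assumes "p \<in> U" "u \<in> T p"
  shows "g p u (\<Sum>i\<in>N. c i *\<^sub>R X i p) = (\<Sum>i\<in>N. c i * g p u (X i p))"
    and "g p (\<Sum>i\<in>N. c i *\<^sub>R X i p) u = (\<Sum>i\<in>N. c i * g p u (X i p))"
proof -
  show *: "g p u (\<Sum>i\<in>N. c i *\<^sub>R X i p) = (\<Sum>i\<in>N. c i * g p u (X i p))"
    by (rule g_sum_right[OF assms(2) X_T[OF assms(1)]])
  have "(\<Sum>i\<in>N. c i *\<^sub>R X i p) \<in> T p"
    using X_T[OF assms(1)] by (intro tangent_intros)
  then show "g p (\<Sum>i\<in>N. c i *\<^sub>R X i p) u = (\<Sum>i\<in>N. c i * g p u (X i p))"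
    using * g_commute[OF assms(2)] by simp
qed

lemma hor_g:
  assumes "p \<in> U" "v \<in> T p" "\<theta> p v = 0" "u \<in> T p"
  shows "g p u v = (\<Sum>i\<in>N. g p u (X i p) * g p v (X i p))"
proof -
  have "g p u v = g p u (\<Sum>i\<in>N. g p v (X i p) *\<^sub>R X i p)"
    using hor_expand[OF assms(1-3)] by simp
  then show ?thesis
    using g_sum_X(1)[OF assms(1,4)] by (simp only: mult.commute)
qed

section \<open>The form \<open>b\<close>, brackets of horizontal fields and \<open>J\<close>\<close>

lemma vf_J: "vf Y \<Longrightarrow> vf (\<lambda>p. J p (Y p))"
  using endo open_U unfolding endo_tensor_def by blast

lemma b_ext_deriv: "vf Y \<Longrightarrow> vf W \<Longrightarrow> p \<in> U \<Longrightarrow> b p (Y p) (W p) = ext_deriv \<A> \<theta> Y W p"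
  using contact open_U unfolding contact_riemannian_def b_def by blast

lemma sm_b: "vf Y \<Longrightarrow> vf W \<Longrightarrow> sm (\<lambda>p. b p (Y p) (W p))"
  unfolding b_def using smooth_g[OF open_U _ vf_J] .

lemma b_hor:
  assumes "hor Y" "hor W" "p \<in> U"
  shows "b p (Y p) (W p) = - \<theta> p (lie_bracket \<A> Y W p)"
proof -
  have "Y p (\<lambda>q. \<theta> q (W q)) = 0" "W p (\<lambda>q. \<theta> q (Y q)) = 0"
    by (rule vfield_eq_const[OF hor_vf[OF assms(1)] assms(3) hor_theta[OF assms(2)]]; assumption)
       (rule vfield_eq_const[OF hor_vf[OF assms(2)] assms(3) hor_theta[OF assms(1)]]; assumption)
  then show ?thesis
    using b_ext_deriv[OF hor_vf hor_vf] assms by (simp add: ext_deriv_def)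
qed

text \<open>Skewness is not visible in \<open>g p u (J p v)\<close>; it comes from the bracket
  through \<open>b_hor\<close>.\<close>

lemma b_antisym:
  assumes "hor Y" "hor W" "p \<in> U"
  shows "b p (Y p) (W p) = - b p (W p) (Y p)"
proof -
  have "lie_bracket \<A> W Y p \<in> T p"
    using assms vf_T vf_bracket hor_vf by blast
  then have "\<theta> p (- 1 *\<^sub>R lie_bracket \<A> W Y p) = - \<theta> p (lie_bracket \<A> W Y p)"
    by (subst theta_scale) auto
  then show ?thesis
    using b_hor[OF assms] b_hor[OF assms(2,1,3)] lie_bracket_antisym[of \<A> Y W p] by simp
qed

lemma torsion_at: "torsion \<A> D Y W p = D Y W p - D W Y p - lie_bracket \<A> Y W p"
  by (simp add: torsion_def)

lemma torsion_hor:
  assumes "hor Y" "hor W" "p \<in> U"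
  shows "torsion \<A> D Y W p = b p (Y p) (W p) *\<^sub>R Z p"
proof -
  have "torsion \<A> D Y W p = ext_deriv \<A> \<theta> Y W p *\<^sub>R Z p"
    using tanno[unfolded tanno_connection_def, THEN conjunct2, THEN conjunct2, rule_format, of U Y W p]
      open_U assms by (simp add: hor_def)
  then show ?thesis
    using b_ext_deriv[OF hor_vf hor_vf] assms by simp
qed

lemma bracket_hor:
  assumes "hor Y" "hor W" "p \<in> U"
  shows "lie_bracket \<A> Y W p = D Y W p - D W Y p - b p (Y p) (W p) *\<^sub>R Z p"
  using torsion_hor[OF assms] unfolding torsion_at by (simp add: algebra_simps)

text \<open>The relation between the fields is assumed at \<open>p\<close> alone, which suffices by
  tensoriality. It is shaped for the three terms of \<open>bracket_hor\<close>, with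
  \<open>Z\<close> as the last field.\<close>

lemma conn_lin:
  assumes "p \<in> U" "vf Y" "vf Y1" "vf Y2" "vf Y3" "vf W" "Y p = Y1 p - Y2 p - c *\<^sub>R Y3 p"
  shows "D Y W p = D Y1 W p - D Y2 W p - c *\<^sub>R D Y3 W p"
proof -
  note t = conn_tensorial[OF D_linear open_U assms(1) subset_refl _ assms(6)]
  have "g p (Y p) (E a p) *\<^sub>R D (E a) W p = g p (Y1 p) (E a p) *\<^sub>R D (E a) W p
     - g p (Y2 p) (E a p) *\<^sub>R D (E a) W p - c *\<^sub>R g p (Y3 p) (E a p) *\<^sub>R D (E a) W p"
    if "a \<in> insert 0 N" for a
    unfolding assms(7)
    using assms vf_T[OF _ assms(1)] e_tangent[OF assms(1) that]
    by (subst g_diff_left, simp_all add: tangent_intros g_diff_left g_scale_left scaleR_diff_left)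
  then have "D Y W p = (\<Sum>a\<in>insert 0 N. g p (Y1 p) (E a p) *\<^sub>R D (E a) W p
     - g p (Y2 p) (E a p) *\<^sub>R D (E a) W p - c *\<^sub>R g p (Y3 p) (E a p) *\<^sub>R D (E a) W p)"
    unfolding t[OF assms(2)] by (intro sum.cong refl)
  then show ?thesis
    by (simp only: t[OF assms(3)] t[OF assms(4)] t[OF assms(5)] sum_subtractf scaleR_sum_right)
qed

lemma J_T: "v \<in> T p \<Longrightarrow> J p v \<in> T p"
  using endo by (auto simp: endo_tensor_def)

lemma b_sum_right:
  assumes "u \<in> T p" "\<And>i. i \<in> K \<Longrightarrow> v i \<in> T p"
  shows "b p u (\<Sum>i\<in>K. c i *\<^sub>R v i) = (\<Sum>i\<in>K. c i * b p u (v i))"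
proof -
  have "lin_on (T p) (J p)" using endo by (auto simp: endo_tensor_def)
  then have "J p (\<Sum>i\<in>K. c i *\<^sub>R v i) = (\<Sum>i\<in>K. c i *\<^sub>R J p (v i))"
    by (rule lin_on_sum[OF _ subspace_tangent_space assms(2)])
  then show ?thesis
    unfolding b_def using g_sum_right[OF assms(1) J_T[OF assms(2)], of K "\<lambda>i. i"] by simp
qed

lemma b_add_right:
  assumes "u \<in> T p" "v \<in> T p" "w \<in> T p"
  shows "b p u (v + w) = b p u v + b p u w"
proof -
  have "lin_on (T p) (J p)" using endo by (auto simp: endo_tensor_def)
  from this[unfolded lin_on_def, rule_format, OF assms(2,3), of 1 1]
  show ?thesis
    unfolding b_def using assms by (simp add: g_add_right J_T)
qed

text \<open>The \<open>Z\<close>-component of \<open>J Y\<close> is d\<theta>(Z, Y), and contracting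
  d\<theta> with the Reeb field gives zero because \<theta>(Z) = 1 and the Lie derivative of
  \<theta> along \<open>Z\<close> vanishes.\<close>

lemma hor_J:
  assumes "hor Y"
  shows "hor (\<lambda>p. J p (Y p))"
  unfolding hor_def
proof (intro conjI ballI)
  fix q assume q: "q \<in> U"
  have Y: "vf Y" using assms hor_vf by blast
  have "\<theta> q (J q (Y q)) = b q (Z q) (Y q)"
    unfolding b_def using g_Z[of "J q (Y q)" q] g_commute[of "J q (Y q)" q "Z q"] J_T vf_T[OF Y q] Z_T[OF q] by simp
  also have "\<dots> = Z q (\<lambda>q. \<theta> q (Y q)) - Y q (\<lambda>q. \<theta> q (Z q)) - \<theta> q (lie_bracket \<A> Z Y q)"
    unfolding b_ext_deriv[OF Z_smooth Y q] ext_deriv_def ..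
  also have "\<dots> = - Y q (\<lambda>q. \<theta> q (Z q))"
    using reeb[unfolded reeb_field_def, THEN conjunct2, THEN conjunct2, rule_format, of U Y q] Y q open_U
    by simp
  also have "\<dots> = 0"
    using vfield_eq_const[OF Y q, of _ 1] theta_Z by simp
  finally show "\<theta> q (J q (Y q)) = 0" .
qed (use assms vf_J hor_vf in auto)

text \<open>For fixed \<open>j\<close> the sum over \<open>i\<close> is the squared length of
  \<open>J (X j)\<close> by Parseval; skewness of \<open>b\<close> and J^2 = -1 make it 1, and
  \<open>j\<close> takes 2n values.\<close>

lemma sum_b_sq:
  assumes "p \<in> U"
  shows "(\<Sum>i\<in>N. \<Sum>j\<in>N. (b p (X i p) (X j p))\<^sup>2) = 2 * real n"
proof -
  have "(\<Sum>i\<in>N. (b p (X i p) (X j p))\<^sup>2) = 1" if j: "j \<in> N" for j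
  proof -
    note h = hor_J[OF hor_X[OF j]]
    have t: "J p (X j p) \<in> T p" using J_T X_T assms j by blast
    have "(\<Sum>i\<in>N. (b p (X i p) (X j p))\<^sup>2) = g p (J p (X j p)) (J p (X j p))"
      unfolding hor_g[OF assms t hor_theta[OF h assms] t] b_def
      using assms t X_T by (intro sum.cong refl) (simp add: g_commute power2_eq_square)
    also have "\<dots> = b p (J p (X j p)) (X j p)"
      by (simp add: b_def)
    also have "\<dots> = - b p (X j p) (J p (X j p))"
      using b_antisym[OF h hor_X[OF j] assms] .
    also have "\<dots> = - g p (X j p) (- 1 *\<^sub>R X j p)"
      unfolding b_def using J_J[OF X_T[OF assms j]] theta_X[OF assms j] by simp
    also have "\<dots> = 1"
      by (subst g_scale_right) (use X_T assms j X_ortho in auto)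
    finally show ?thesis .
  qed
  then have "(\<Sum>j\<in>N. \<Sum>i\<in>N. (b p (X i p) (X j p))\<^sup>2) = 2 * real n"
    by simp
  then show ?thesis by (subst sum.swap)
qed

lemma horizontal_gradient_frame:
  assumes "p \<in> U"
  shows "horizontal_gradient \<A> \<theta> g f p = (\<Sum>i\<in>N. X i p f *\<^sub>R X i p)"
  unfolding horizontal_gradient_def
proof (rule the_equality)
  have G: "gradient \<A> g f p \<in> T p"
    unfolding gradient_frame[OF assms] using e_tangent[OF assms] by (intro tangent_intros)
  let ?S = "\<Sum>i\<in>N. X i p f *\<^sub>R X i p"
  have t: "?S \<in> T p"
    using X_T[OF assms] by (intro tangent_intros)
  have h: "?S \<in> horizontal_space \<A> \<theta> p"
    unfolding horizontal_space_def using t theta_sum[OF X_T[OF assms], of N "\<lambda>i. i"] theta_X[OF assms] by simp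
  have "g p (gradient \<A> g f p - ?S) w = 0" if w: "w \<in> horizontal_space \<A> \<theta> p" for w
  proof -
    have wT: "w \<in> T p" "\<theta> p w = 0" using w by (auto simp: horizontal_space_def)
    have "g p ?S w = (\<Sum>i\<in>N. g p w (X i p) * X i p f)"
      unfolding g_sum_X(2)[OF assms wT(1)] by (simp only: mult.commute)
    also have "\<dots> = w f"
      using hor_apply[OF assms wT] by simp
    finally show ?thesis
      using g_diff_left[OF wT(1) G t] g_gradient[OF assms wT(1)] by simp
  qed
  with h show "?S \<in> horizontal_space \<A> \<theta> p \<and> (\<forall>w\<in>horizontal_space \<A> \<theta> p. g p (gradient \<A> g f p - ?S) w = 0)"
    by blast
  fix v assume v: "v \<in> horizontal_space \<A> \<theta> p \<and> (\<forall>w\<in>horizontal_space \<A> \<theta> p. g p (gradient \<A> g f p - v) w = 0)"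
  then have vT: "v \<in> T p" by (auto simp: horizontal_space_def)
  have "g p v (X i p) = X i p f" if i: "i \<in> N" for i
  proof -
    have "g p (gradient \<A> g f p - v) (X i p) = 0"
      using v X_hor_space[OF assms i] by blast
    then show ?thesis
      using g_diff_left[OF X_T[OF assms i] G vT] g_gradient[OF assms X_T[OF assms i]] by simp
  qed
  then show "v = ?S"
    using horizontal_space_expand[OF assms, of v] v by auto
qed

end

section \<open>The horizontal Bochner formula\<close>

context contact_frame
begin

lemma theta_bracket_Z:
  assumes "hor Y" "p \<in> U"
  shows "\<theta> p (lie_bracket \<A> Z Y p) = 0"
proof -
  have "Z p (\<lambda>q. \<theta> q (Y q)) = 0"
    by (rule vfield_eq_const[OF Z_smooth assms(2) hor_theta[OF assms(1)]]; assumption)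
  then show ?thesis
    using reeb[unfolded reeb_field_def, THEN conjunct2, THEN conjunct2, rule_format, of U Y p]
      hor_vf[OF assms(1)] assms(2) open_U by simp
qed

lemma D_metric_at:
  "p \<in> U \<Longrightarrow> vf Y \<Longrightarrow> vf V \<Longrightarrow> vf W \<Longrightarrow>
    Y p (\<lambda>q. g q (V q) (W q)) = g p (D Y V p) (W p) + g p (V p) (D Y W p)"
  using metric_conn[OF D_metric] .

lemma D_X_antisym:
  assumes "vf Y" "p \<in> U" "i \<in> N" "j \<in> N"
  shows "g p (D Y (X i) p) (X j p) = - g p (X i p) (D Y (X j) p)"
proof -
  have "Y p (\<lambda>q. g q (X i q) (X j q)) = 0"
    by (rule vfield_eq_const[OF assms(1,2) X_ortho[OF _ assms(3,4)]])
  then show ?thesis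
    using D_metric_at[OF assms(2,1) X_smooth[OF assms(3)] X_smooth[OF assms(4)]] by simp
qed

text \<open>The formula of \<open>levi_civita_diag\<close> survives because the torsion of two
  horizontal fields is a multiple of \<open>Z\<close>, which is orthogonal to
  \<open>X i\<close>.\<close>

lemma tanno_diag:
  assumes "p \<in> U" "i \<in> N" "j \<in> N"
  shows "g p (D (X i) (X i) p) (X j p) = - g p (X i p) (lie_bracket \<A> (X i) (X j) p)"
proof -
  note h = hor_X[OF assms(2)] hor_X[OF assms(3)]
  note s = X_smooth[OF assms(2)] X_smooth[OF assms(3)]
  note t = X_T[OF assms(1,2)] X_T[OF assms(1,3)] Z_T[OF assms(1)]
    vf_T[OF vf_D[OF s(1,2)] assms(1)] vf_T[OF vf_D[OF s(2,1)] assms(1)]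
  have "g p (X i p) (D (X j) (X i) p) = 0"
    using D_X_antisym[OF s(2) assms(1,2,2)] g_commute[OF t(1,5)] by simp
  then have "g p (X i p) (lie_bracket \<A> (X i) (X j) p) = g p (X i p) (D (X i) (X j) p)"
    using t unfolding bracket_hor[OF h assms(1)]
    by (simp add: g_diff_right g_scale_right tangent_intros g_Z theta_X[OF assms(1,2)])
  then show ?thesis
    using D_X_antisym[OF s(1) assms] by simp
qed

text \<open>The Levi-Civita and Tanno connections have the same divergence on horizontal fields: both
  \<open>\<Sum>a. LC (E a) (E a)\<close> and \<open>\<Sum>i. D (X i) (X i)\<close> are determined by the brackets of the frame.\<close>

lemma sub_laplacian_frame:
  assumes "levi_civita \<A> g LC" "p \<in> U" "sm h"
    and div: "(\<Sum>i\<in>N. g p (X i p) (lie_bracket \<A> (X i) Z p)) = 0"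
  shows "sub_laplacian \<A> Z g LC h p = (\<Sum>i\<in>N. X i p (\<lambda>q. X i q h) - D (X i) (X i) p h)"
proof -
  have l: "linear_connection \<A> LC"
    using assms(1) by (auto simp: levi_civita_def metric_connection_def)
  have sE: "vf (E a)" if "a \<in> insert 0 N" for a
    using smooth_e[OF that] .
  have t1: "LC (E a) (E a) p \<in> T p" if "a \<in> insert 0 N" for a
    using conn_tangent[OF l open_U sE[OF that] sE[OF that] assms(2)] .
  have t2: "D (X i) (X i) p \<in> T p" if "i \<in> N" for i
    using vf_T[OF vf_D[OF X_smooth[OF that] X_smooth[OF that]] assms(2)] .
  have "(\<Sum>a\<in>insert 0 N. LC (E a) (E a) p) = (\<Sum>i\<in>N. D (X i) (X i) p)"
  proof (rule eq_by_frame[OF assms(2)])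
    fix c assume c: "c \<in> insert 0 N"
    note cT = e_tangent[OF assms(2) c]
    have "g p (\<Sum>a\<in>insert 0 N. LC (E a) (E a) p) (E c p)
        = (\<Sum>a\<in>insert 0 N. - g p (E a p) (lie_bracket \<A> (E a) (E c) p))"
      using g_sum_left[OF cT t1, of "insert 0 N" "\<lambda>a. a" "\<lambda>_. 1"] levi_civita_diag[OF assms(1,2) _ c]
      by simp
    also have "\<dots> = - g p (Z p) (lie_bracket \<A> Z (E c) p) - (\<Sum>i\<in>N. g p (X i p) (lie_bracket \<A> (X i) (E c) p))"
      using sum_E[of "\<lambda>Y. - g p (Y p) (lie_bracket \<A> Y (E c) p)"] by (simp add: sum_negf)
    also have "g p (Z p) (lie_bracket \<A> Z (E c) p) = \<theta> p (lie_bracket \<A> Z (E c) p)"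
      using g_Z g_commute Z_T[OF assms(2)] vf_T[OF vf_bracket[OF Z_smooth sE[OF c]] assms(2)] by metis
    \<comment> \<open>The summand with index 0 drops out for every \<open>c\<close>:
      \<open>\<theta>\<close> annihilates the bracket of \<open>Z\<close> with itself and with any
      horizontal field.\<close>
    also have "\<dots> = 0"
    proof (cases "c = 0")
      case True
      have "lie_bracket \<A> Z Z p = 0 *\<^sub>R Z p"
        by (rule ext) (simp add: lie_bracket_def)
      then show ?thesis
        using True theta_scale[OF Z_T[OF assms(2)], of 0] by (simp add: E_def)
    next
      case False
      then show ?thesis
        using c theta_bracket_Z[OF hor_X assms(2)] by (simp add: E_def)
    qed
    also have "- 0 - (\<Sum>i\<in>N. g p (X i p) (lie_bracket \<A> (X i) (E c) p)) = (\<Sum>i\<in>N. g p (D (X i) (X i) p) (E c p))"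
    proof (cases "c = 0")
      case True
      \<comment> \<open>In the \<open>Z\<close>-direction the right-hand side vanishes by
        horizontality, the left-hand side by \<open>div\<close>, whose sum is the divergence of
        \<open>Z\<close>.\<close>
      have "g p (D (X i) (X i) p) (Z p) = 0" if "i \<in> N" for i
        using g_Z[OF t2[OF that]] hor_theta[OF hor_D[OF X_smooth[OF that] hor_X[OF that]] assms(2)] by simp
      then show ?thesis using True div by (simp add: E_def)
    next
      case False
      then have "c \<in> N" using c by simp
      then show ?thesis
        using False tanno_diag[OF assms(2)] by (simp add: E_def sum_negf)
    qed
    also have "\<dots> = g p (\<Sum>i\<in>N. D (X i) (X i) p) (E c p)"
      using g_sum_left[OF cT t2, of N "\<lambda>a. a" "\<lambda>_. 1"] by simp
    finally show "g p (\<Sum>a\<in>insert 0 N. LC (E a) (E a) p) (E c p) = g p (\<Sum>i\<in>N. D (X i) (X i) p) (E c p)" .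
  qed (rule tangent_intros(4), erule t1, rule tangent_intros(4), erule t2)
  then have "(\<Sum>a\<in>insert 0 N. LC (E a) (E a) p) h = (\<Sum>i\<in>N. D (X i) (X i) p) h"
    by (rule arg_cong)
  then have "(\<Sum>a\<in>insert 0 N. LC (E a) (E a) p h) = (\<Sum>i\<in>N. D (X i) (X i) p h)"
    unfolding tvec_sum_apply .
  moreover have "(\<Sum>a\<in>insert 0 N. E a p (\<lambda>q. E a q h)) = Z p (\<lambda>q. Z q h) + (\<Sum>i\<in>N. X i p (\<lambda>q. X i q h))"
    by (rule sum_E)
  ultimately show ?thesis
    unfolding sub_laplacian_def laplace_beltrami_frame[OF assms(1-3)] sum_subtractf by simp
qed

text \<open>Derivatives of \<open>c\<close> from the connection and from the bracket cancel; the
  sign comes from exchanging the arguments. \<open>W\<close> is tied to \<open>Z\<close> on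
  \<open>U\<close> only, since it will be the torsion of two frame fields.\<close>

lemma torsion_scale_Z:
  assumes "vf Y" "p \<in> U" "sm c" "\<And>q. q \<in> U \<Longrightarrow> W q = c q *\<^sub>R Z q"
  shows "torsion \<A> D Y W p = - c p *\<^sub>R torsion \<A> D Z Y p"
proof -
  have cZ: "vf (\<lambda>q. c q *\<^sub>R Z q)"
    by (rule smooth_vfield_scale[OF atlas Z_smooth assms(3)])
  have 1: "D Y W p = Y p c *\<^sub>R Z p"
    using conn_cong[OF D_linear open_U assms(1) cZ assms(2), of Y W] assms(4)
      conn_scale_right[OF D_linear open_U assms(2,1) Z_smooth assms(3)] D_Z[OF assms(1,2)] by simp
  have 2: "D W Y p = c p *\<^sub>R D Z Y p"
    using conn_cong[OF D_linear open_U cZ assms(1) assms(2), of W Y] assms(4)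
      conn_scale_left[OF D_linear open_U assms(2) Z_smooth assms(1,3)] by simp
  have "lie_bracket \<A> W Y p = c p *\<^sub>R lie_bracket \<A> Z Y p - Y p c *\<^sub>R Z p"
    using lie_bracket_cong[OF atlas open_U assms(2) cZ assms(1), of W Y] assms(4)
      lie_bracket_scale_left[OF atlas open_U assms(2) Z_smooth assms(1,3)] by simp
  then have 3: "lie_bracket \<A> Y W p = Y p c *\<^sub>R Z p - c p *\<^sub>R lie_bracket \<A> Z Y p"
    using lie_bracket_antisym[of \<A> Y W p] by simp
  show ?thesis
    unfolding torsion_at 1 2 3 D_Z[OF assms(1,2)] by (simp add: algebra_simps)
qed

text \<open>The torsion is \<open>b\<close> times the parallel field \<open>Z\<close>, so only
  \<open>b\<close> is differentiated: the coefficient is the covariant derivative of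
  d\<theta>.\<close>

lemma cov_torsion_hor:
  assumes "vf V" "hor Y" "hor W" "p \<in> U"
  shows "cov_torsion \<A> D V Y W p =
    (V p (\<lambda>q. b q (Y q) (W q)) - b p (D V Y p) (W p) - b p (Y p) (D V W p)) *\<^sub>R Z p"
proof -
  note sb = sm_b[OF hor_vf[OF assms(2)] hor_vf[OF assms(3)]]
  have "D V (torsion \<A> D Y W) p = D V (\<lambda>q. b q (Y q) (W q) *\<^sub>R Z q) p"
    by (rule conn_cong[OF D_linear open_U assms(1) _ assms(4)])
       (auto simp: torsion_hor[OF assms(2,3)] intro: smooth_vfield_scale atlas Z_smooth sb)
  also have "\<dots> = V p (\<lambda>q. b q (Y q) (W q)) *\<^sub>R Z p"
    using conn_scale_right[OF D_linear open_U assms(4,1) Z_smooth sb] D_Z[OF assms(1,4)] by simp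
  finally have 1: "D V (torsion \<A> D Y W) p = V p (\<lambda>q. b q (Y q) (W q)) *\<^sub>R Z p" .
  have "cov_torsion \<A> D V Y W p = D V (torsion \<A> D Y W) p - torsion \<A> D (D V Y) W p - torsion \<A> D Y (D V W) p"
    by (simp add: cov_torsion_def)
  then show ?thesis
    unfolding 1 torsion_hor[OF hor_D[OF assms(1,2)] assms(3,4)]
      torsion_hor[OF assms(2) hor_D[OF assms(1,3)] assms(4)]
    by (simp only: scaleR_diff_left)
qed

end

text \<open>The conditions on the coefficients \<delta> enter as \<open>div_Z\<close>, the vanishing
  of the divergence of \<open>Z\<close>.\<close>

locale contact_frame_fun = contact_frame \<A> n \<theta> Z g J D U X
  for \<A> :: "('m::topological_space, 'e::euclidean_space) atlas" and n \<theta> Z g J D U X +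
  fixes f :: "'m \<Rightarrow> real" and LC
  assumes sm_f: "smooth_fun \<A> U f"
    and LC: "levi_civita \<A> g LC"
    and div_Z: "\<And>p. p \<in> U \<Longrightarrow> (\<Sum>i\<in>N. g p (X i p) (lie_bracket \<A> (X i) Z p)) = 0"
begin

abbreviation G :: "'m vfield" where "G \<equiv> horizontal_gradient \<A> \<theta> g f"

abbreviation L :: "('m \<Rightarrow> real) \<Rightarrow> 'm \<Rightarrow> real" where "L \<equiv> sub_laplacian \<A> Z g LC"

section \<open>Sub-Laplacian, \<Gamma> and horizontal gradient in the frame\<close>

lemma L_frame: "p \<in> U \<Longrightarrow> sm h \<Longrightarrow> L h p = (\<Sum>i\<in>N. X i p (\<lambda>q. X i q h) - D (X i) (X i) p h)"
  using sub_laplacian_frame[OF LC] div_Z by blast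

lemma sm_L: assumes "sm h" shows "sm (L h)"
proof (rule smooth_fun_cong[OF atlas open_U L_frame[OF _ assms, symmetric]])
  show "sm (\<lambda>p. \<Sum>i\<in>N. X i p (\<lambda>q. X i q h) - D (X i) (X i) p h)"
    by (intro smooth_fun_sum[OF atlas open_U] smooth_fun_diff[OF atlas open_U] sm_vf[OF X_smooth]
        sm_vf[OF vf_D[OF X_smooth X_smooth]] assms)
qed

text \<open>\<open>L\<close> has no zero-order term and its first-order part is a derivation, so the
  defect of the product rule consists of the mixed terms of \<open>tv_comp_mult\<close>.\<close>

lemma Gam_frame:
  assumes "p \<in> U" "sm h" "sm k"
  shows "Gam L h k p = (\<Sum>i\<in>N. X i p h * X i p k)"
proof -
  note nh = near[OF assms(1,2)] and nk = near[OF assms(1,3)]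
  have "X i p (\<lambda>q. X i q (\<lambda>r. h r * k r)) - D (X i) (X i) p (\<lambda>r. h r * k r)
     = 2 * (X i p h * X i p k) + h p * (X i p (\<lambda>q. X i q k) - D (X i) (X i) p k)
      + k p * (X i p (\<lambda>q. X i q h) - D (X i) (X i) p h)" if i: "i \<in> N" for i
    using tv_comp_mult[OF atlas open_U assms(1) X_T[OF assms(1) i] X_smooth[OF i] nh nk]
      tv_mult[OF vf_T[OF vf_D[OF X_smooth[OF i] X_smooth[OF i]] assms(1)] nh nk]
    by (simp add: algebra_simps)
  then have "L (\<lambda>q. h q * k q) p = (\<Sum>i\<in>N. 2 * (X i p h * X i p k) + h p * (X i p (\<lambda>q. X i q k) - D (X i) (X i) p k)
      + k p * (X i p (\<lambda>q. X i q h) - D (X i) (X i) p h))"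
    unfolding L_frame[OF assms(1) smooth_fun_mult[OF atlas open_U assms(2,3)]] by (intro sum.cong refl)
  then have "L (\<lambda>q. h q * k q) p = 2 * (\<Sum>i\<in>N. X i p h * X i p k) + h p * L k p + k p * L h p"
    unfolding L_frame[OF assms(1,2)] L_frame[OF assms(1,3)] by (simp only: sum.distrib sum_distrib_left)
  then show ?thesis by (simp add: Gam_def)
qed

lemma vf_G: "vf G"
proof (rule smooth_vfield_cong[OF atlas horizontal_gradient_frame[symmetric]])
  show "vf (\<lambda>p. \<Sum>i\<in>N. X i p f *\<^sub>R X i p)"
    by (intro smooth_vfield_sum smooth_vfield_scale atlas X_smooth sm_vf[OF X_smooth sm_f])
qed

lemma hor_G: "hor G"
  unfolding hor_def
proof (intro conjI ballI vf_G)
  fix q assume q: "q \<in> U"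
  have "\<theta> q (G q) = (\<Sum>i\<in>N. X i q f * \<theta> q (X i q))"
    unfolding horizontal_gradient_frame[OF q] by (rule theta_sum[OF X_T[OF q]])
  also have "\<dots> = 0"
    by (rule sum.neutral) (simp add: theta_X[OF q])
  finally show "\<theta> q (G q) = 0" .
qed

lemma G_T: "p \<in> U \<Longrightarrow> G p \<in> T p"
  using vf_T[OF vf_G] .

lemma G_apply: "p \<in> U \<Longrightarrow> G p h = (\<Sum>i\<in>N. X i p f * X i p h)"
  by (simp add: horizontal_gradient_frame tvec_sum_apply scaleR_fun_def)

text \<open>\<open>G\<close> represents the differential of \<open>f\<close> on horizontal vectors
  only, so \<open>\<theta> p v = 0\<close> excludes a contribution of \<open>Z p f\<close>.\<close>

lemma g_G:
  assumes "p \<in> U" "v \<in> T p" "\<theta> p v = 0"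
  shows "g p (G p) v = v f"
proof -
  have "g p (G p) v = (\<Sum>i\<in>N. X i p f * g p v (X i p))"
    unfolding horizontal_gradient_frame[OF assms(1)] by (rule g_sum_X(2)[OF assms(1,2)])
  also have "\<dots> = (\<Sum>i\<in>N. g p v (X i p) * X i p f)"
    by (simp only: mult.commute)
  also have "\<dots> = v f"
    by (rule hor_apply[OF assms, symmetric])
  finally show ?thesis .
qed

text \<open>Differentiates \<open>W f\<close> as the inner product of \<open>G\<close> and
  \<open>W\<close>; the term with \<open>D Y W\<close> is evaluated by \<open>g_G\<close>, which is
  why \<open>W\<close> must be horizontal. \<open>Y\<close> need not be, and
  \<open>hessian_Z\<close> takes it to be \<open>Z\<close>.\<close>

lemma hessian:
  assumes "vf Y" "hor W" "p \<in> U"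
  shows "g p (D Y G p) (W p) = Y p (\<lambda>q. W q f) - D Y W p f"
proof -
  note W = hor_vf[OF assms(2)]
  have "Y p (\<lambda>q. W q f) = Y p (\<lambda>q. g q (G q) (W q))"
    by (rule vfield_cong[OF assms(1,3) sm_vf[OF W sm_f]]) (simp add: g_G vf_T[OF W] hor_theta[OF assms(2)])
  also have "\<dots> = g p (D Y G p) (W p) + g p (G p) (D Y W p)"
    by (rule D_metric_at[OF assms(3,1) vf_G W])
  also have "g p (G p) (D Y W p) = D Y W p f"
    using hor_D[OF assms(1,2)] by (intro g_G assms(3) vf_T hor_theta hor_vf)
  finally show ?thesis by simp
qed

text \<open>The Hessian of a connection with torsion is not symmetric; all first-order terms of the
  Bochner formula other than the curvature come from this defect.\<close>

lemma hessian_commute: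
  assumes "hor Y" "hor W" "p \<in> U"
  shows "g p (D Y G p) (W p) = g p (D W G p) (Y p) - b p (Y p) (W p) * Z p f"
proof -
  have "lie_bracket \<A> Y W p f = D Y W p f - D W Y p f - b p (Y p) (W p) * Z p f"
    unfolding bracket_hor[OF assms] by (simp add: scaleR_fun_def)
  moreover have "lie_bracket \<A> Y W p f = Y p (\<lambda>q. W q f) - W p (\<lambda>q. Y q f)"
    by (rule lie_bracket_apply[OF near[OF assms(3) sm_f]])
  ultimately show ?thesis
    unfolding hessian[OF hor_vf[OF assms(1)] assms(2,3)] hessian[OF hor_vf[OF assms(2)] assms(1,3)] by simp
qed

text \<open>Since \<open>Z\<close> is parallel, T(Z, Y) is \<open>D Z Y\<close> minus the bracket,
  and the bracket exchanges the two derivatives of \<open>f\<close>.\<close>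

lemma hessian_Z:
  assumes "hor Y" "p \<in> U"
  shows "g p (D Z G p) (Y p) = Y p (\<lambda>q. Z q f) - torsion \<A> D Z Y p f"
  unfolding hessian[OF Z_smooth assms] torsion_at D_Z[OF hor_vf[OF assms(1)] assms(2)]
  by (simp add: lie_bracket_apply[OF near[OF assms(2) sm_f]])

section \<open>Expansion of \<Gamma>2 and of the Ricci term\<close>

lemma L_f: "p \<in> U \<Longrightarrow> L f p = (\<Sum>i\<in>N. g p (D (X i) G p) (X i p))"
  unfolding L_frame[OF _ sm_f] by (intro sum.cong refl) (simp only: hessian[OF X_smooth hor_X])

text \<open>\<Gamma>(f, f) is the squared length of \<open>G\<close>, and \<Gamma>(f, L f) is
  \<open>G\<close> applied to the trace of the Hessian. Metric compatibility differentiates both; as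
  the frame moves along \<open>G\<close>, the second also yields \<open>D G (X i)\<close>.\<close>

lemma Gam2_eq:
  assumes p: "p \<in> U"
  shows "Gam2 L f p = (\<Sum>i\<in>N. g p (D (X i) (D (X i) G) p) (G p) + g p (D (X i) G p) (D (X i) G p)
      - g p (D (D (X i) (X i)) G p) (G p))
    - (\<Sum>i\<in>N. g p (D G (D (X i) G) p) (X i p) + g p (D (X i) G p) (D G (X i) p))"
proof -
  have GG: "Gam L f f q = g q (G q) (G q)" if q: "q \<in> U" for q
    unfolding Gam_frame[OF q sm_f sm_f] hor_g[OF q G_T[OF q] hor_theta[OF hor_G q] G_T[OF q]]
    by (intro sum.cong refl) (simp only: g_G[OF q X_T[OF q] theta_X[OF q]])
  have smGG: "sm (\<lambda>q. g q (G q) (G q))"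
    by (rule smooth_g[OF open_U vf_G vf_G])
  have smGam: "sm (Gam L f f)"
    by (rule smooth_fun_cong[OF atlas open_U GG[symmetric] smGG])
  have d: "Y q (Gam L f f) = 2 * g q (D Y G q) (G q)" if Y: "vf Y" and q: "q \<in> U" for Y q
  proof -
    have "Y q (Gam L f f) = Y q (\<lambda>q. g q (G q) (G q))"
      by (rule vfield_cong[OF Y q smGam GG])
    then show ?thesis
      using D_metric_at[OF q Y vf_G vf_G] g_commute[OF G_T[OF q] vf_T[OF vf_D[OF Y vf_G] q]] by simp
  qed
  have dd: "X i p (\<lambda>q. X i q (Gam L f f)) = 2 * (g p (D (X i) (D (X i) G) p) (G p) + g p (D (X i) G p) (D (X i) G p))"
    if i: "i \<in> N" for i
  proof -
    have DG: "vf (D (X i) G)" by (rule vf_D[OF X_smooth[OF i] vf_G])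
    note s = smooth_g[OF open_U DG vf_G]
    have "X i p (\<lambda>q. X i q (Gam L f f)) = X i p (\<lambda>q. 2 * g q (D (X i) G q) (G q))"
      by (rule vfield_cong[OF X_smooth[OF i] p sm_vf[OF X_smooth[OF i] smGam] d[OF X_smooth[OF i]]])
    also have "\<dots> = 2 * X i p (\<lambda>q. g q (D (X i) G q) (G q))"
      by (rule tv_cmult[OF X_T[OF p i] near[OF p s]])
    finally show ?thesis
      unfolding D_metric_at[OF p X_smooth[OF i] DG vf_G] .
  qed
  have "L (Gam L f f) p = 2 * (\<Sum>i\<in>N. g p (D (X i) (D (X i) G) p) (G p) + g p (D (X i) G p) (D (X i) G p)
      - g p (D (D (X i) (X i)) G p) (G p))"
    unfolding L_frame[OF p smGam] sum_distrib_left
    by (intro sum.cong refl) (simp add: dd d[OF vf_D[OF X_smooth X_smooth] p])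
  moreover have "Gam L f (L f) p = (\<Sum>i\<in>N. g p (D G (D (X i) G) p) (X i p) + g p (D (X i) G p) (D G (X i) p))"
  proof -
    have s: "sm (\<lambda>q. g q (D (X i) G q) (X i q))" if "i \<in> N" for i
      by (rule smooth_g[OF open_U vf_D[OF X_smooth[OF that] vf_G] X_smooth[OF that]])
    have "Gam L f (L f) p = G p (L f)"
      unfolding Gam_frame[OF p sm_f sm_L[OF sm_f]] G_apply[OF p] ..
    also have "\<dots> = G p (\<lambda>q. \<Sum>i\<in>N. g q (D (X i) G q) (X i q))"
      by (rule vfield_cong[OF vf_G p sm_L[OF sm_f] L_f])
    also have "\<dots> = (\<Sum>i\<in>N. G p (\<lambda>q. g q (D (X i) G q) (X i q)))"
      by (rule tv_sum[OF G_T[OF p] near[OF p s] atlas])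
    also have "\<dots> = (\<Sum>i\<in>N. g p (D G (D (X i) G) p) (X i p) + g p (D (X i) G p) (D G (X i) p))"
      by (intro sum.cong refl D_metric_at[OF p vf_G] vf_D[OF X_smooth vf_G] X_smooth)
    finally show ?thesis .
  qed
  ultimately show ?thesis
    unfolding Gam2_def by simp
qed

text \<open>The trace runs over the full tangent space, but \<open>D\<close> maps horizontal fields
  to horizontal ones, so the curvature applied to \<open>G\<close> has no \<open>Z\<close>-component
  and the summand of \<open>Z\<close> is zero.\<close>

lemma ricci_G:
  assumes p: "p \<in> U"
  shows "ricci \<A> D G G p = (\<Sum>i\<in>N. g p (D (X i) (D G G) p) (X i p) - g p (D G (D (X i) G) p) (X i p)
    - g p (D (lie_bracket \<A> (X i) G) G p) (X i p))"
proof -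
  have c: "g p (curvature \<A> D Y G G p) w = g p (D Y (D G G) p) w - g p (D G (D Y G) p) w
    - g p (D (lie_bracket \<A> Y G) G p) w" if Y: "vf Y" and w: "w \<in> T p" for Y w
  proof -
    have t: "D Y (D G G) p \<in> T p" "D G (D Y G) p \<in> T p" "D (lie_bracket \<A> Y G) G p \<in> T p"
      using p Y vf_G by (auto intro!: vf_T vf_D vf_bracket)
    have "curvature \<A> D Y G G p = D Y (D G G) p - D G (D Y G) p - D (lie_bracket \<A> Y G) G p"
      by (simp add: curvature_def)
    then show ?thesis
      using g_diff_left[OF w tangent_intros(2)[OF t(1,2)] t(3)] g_diff_left[OF w t(1,2)] by simp
  qed
  have z: "g p (D Y W p) (Z p) = 0" if "vf Y" "hor W" for Y W
    using hor_theta[OF hor_D[OF that] p] g_Z[OF vf_T[OF vf_D[OF that(1) hor_vf[OF that(2)]] p]] by simp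
  have "ricci \<A> D G G p = g p (curvature \<A> D Z G G p) (Z p) + (\<Sum>i\<in>N. g p (curvature \<A> D (X i) G G p) (X i p))"
    unfolding ricci_frame[OF D_linear p vf_G vf_G] by (rule sum_E)
  also have "g p (curvature \<A> D Z G G p) (Z p) = 0"
    unfolding c[OF Z_smooth Z_T[OF p]]
    using Z_smooth vf_G hor_G by (simp add: z hor_D vf_bracket)
  also have "0 + (\<Sum>i\<in>N. g p (curvature \<A> D (X i) G G p) (X i p)) = (\<Sum>i\<in>N. g p (D (X i) (D G G) p) (X i p)
     - g p (D G (D (X i) G) p) (X i p) - g p (D (lie_bracket \<A> (X i) G) G p) (X i p))"
    unfolding add_0 by (intro sum.cong refl c X_smooth X_T[OF p])
  finally show ?thesis .
qed

text \<open>Each move exchanges the two arguments of the Hessian, at the cost of \<open>b\<close>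
  times \<open>Z f\<close>. The squares of \<open>D (X i) G\<close> cancel between 1 and 3. The
  costs in 1, 2 and 3 assemble to the covariant derivative of d\<theta>, and the term with
  \<open>X i (Z f)\<close> appears once in 1 and once in 4.\<close>

lemma commutation_term:
  assumes p: "p \<in> U" and i: "i \<in> N"
  shows "g p (D (X i) (D (X i) G) p) (G p) - g p (D (D (X i) (X i)) G p) (G p)
      - g p (D (X i) (D G G) p) (X i p) + g p (D (lie_bracket \<A> (X i) G) G p) (X i p)
      - g p (D (X i) G p) (D G (X i) p)
    = - (g p (D (D G (X i)) G p) (X i p) + g p (D (X i) G p) (D G (X i) p))
      - 2 * b p (X i p) (G p) * X i p (\<lambda>q. Z q f) + b p (X i p) (G p) * torsion \<A> D Z (X i) p f
      - Z p f * (X i p (\<lambda>q. b q (X i q) (G q)) - b p (D (X i) (X i) p) (G p) - b p (X i p) (D (X i) G p))"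
proof -
  note s = X_smooth[OF i] and h = hor_X[OF i]
  note hDX = hor_D[OF s h] and hDG = hor_D[OF s hor_G] and hGG = hor_D[OF vf_G hor_G] and hGX = hor_D[OF vf_G h]
  note vDX = hor_vf[OF hDX] and vDG = hor_vf[OF hDG] and vGG = hor_vf[OF hGG] and vGX = hor_vf[OF hGX]
  note sb = sm_b[OF s vf_G] and sZ = sm_vf[OF Z_smooth sm_f]
  \<comment> \<open>The exchange holds at every point of \<open>U\<close>, so it may be
    differentiated along \<open>X i\<close>; this exchanges third derivatives of
    \<open>f\<close>.\<close>
  have "X i p (\<lambda>q. g q (D (X i) G q) (G q)) = X i p (\<lambda>q. g q (D G G q) (X i q) - b q (X i q) (G q) * Z q f)"
    by (rule vfield_cong[OF s p smooth_g[OF open_U vDG vf_G]]) (rule hessian_commute[OF h hor_G])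
  also have "\<dots> = X i p (\<lambda>q. g q (D G G q) (X i q)) - (X i p (\<lambda>q. b q (X i q) (G q)) * Z p f
      + b p (X i p) (G p) * X i p (\<lambda>q. Z q f))"
    using tv_diff[OF X_T[OF p i] near[OF p smooth_g[OF open_U vGG s]]
        near[OF p smooth_fun_mult[OF atlas open_U sb sZ]] atlas]
      tv_mult[OF X_T[OF p i] near[OF p sb] near[OF p sZ]] by simp
  finally have 1: "g p (D (X i) (D (X i) G) p) (G p) + g p (D (X i) G p) (D (X i) G p)
     = g p (D (X i) (D G G) p) (X i p) + g p (D G G p) (D (X i) (X i) p)
      - (X i p (\<lambda>q. b q (X i q) (G q)) * Z p f + b p (X i p) (G p) * X i p (\<lambda>q. Z q f))"
    unfolding D_metric_at[OF p s vDG vf_G] D_metric_at[OF p s vGG s] .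
  have 2: "g p (D (D (X i) (X i)) G p) (G p) = g p (D G G p) (D (X i) (X i) p)
     - b p (D (X i) (X i) p) (G p) * Z p f"
    by (rule hessian_commute[OF hDX hor_G p])
  have 3: "g p (D (X i) G p) (D (X i) G p) = g p (D (D (X i) G) G p) (X i p) - b p (X i p) (D (X i) G p) * Z p f"
    by (rule hessian_commute[OF h hDG p])
  \<comment> \<open>The vertical part of the bracket brings in \<open>D Z G\<close>, the source of
    the torsion T(Z, X i).\<close>
  have "D (lie_bracket \<A> (X i) G) G p = D (D (X i) G) G p - D (D G (X i)) G p - b p (X i p) (G p) *\<^sub>R D Z G p"
    by (rule conn_lin[OF p vf_bracket[OF s vf_G] vDG vGX Z_smooth vf_G bracket_hor[OF h hor_G p]])
  then have 4: "g p (D (lie_bracket \<A> (X i) G) G p) (X i p) = g p (D (D (X i) G) G p) (X i p)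
     - g p (D (D G (X i)) G p) (X i p) - b p (X i p) (G p) * (X i p (\<lambda>q. Z q f) - torsion \<A> D Z (X i) p f)"
    using X_T[OF p i] vf_T[OF vf_D[OF vDG vf_G] p] vf_T[OF vf_D[OF vGX vf_G] p] vf_T[OF vf_D[OF Z_smooth vf_G] p]
    by (simp add: g_diff_left g_scale_left tangent_intros hessian_Z[OF h p])
  show ?thesis
    using 1 2 3 4 by (simp add: algebra_simps)
qed

text \<open>\<open>D G (X i)\<close> is a skew combination of the frame fields, paired here with the symmetric
  form \<open>H i k + H k i\<close>.\<close>

lemma rotation_terms_cancel:
  assumes p: "p \<in> U"
  shows "(\<Sum>i\<in>N. g p (D (D G (X i)) G p) (X i p) + g p (D (X i) G p) (D G (X i) p)) = 0"
proof -
  define a where "a i k = g p (D G (X i) p) (X k p)" for i k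
  define H where "H i k = g p (D (X i) G p) (X k p)" for i k
  have a: "a i k = - a k i" if "i \<in> N" "k \<in> N" for i k
    unfolding a_def using D_X_antisym[OF vf_G p that]
      g_commute[OF X_T[OF p that(1)] vf_T[OF vf_D[OF vf_G X_smooth[OF that(2)]] p]] by simp
  have "g p (D (D G (X i)) G p) (X i p) + g p (D (X i) G p) (D G (X i) p) = (\<Sum>k\<in>N. a i k * H k i + a i k * H i k)"
    if i: "i \<in> N" for i
  proof -
    note h = hor_D[OF vf_G hor_X[OF i]]
    note t = vf_T[OF hor_vf[OF h] p] and z = hor_theta[OF h p]
    \<comment> \<open>The \<open>Z\<close>-coefficient is kept only to match the full frame; it
      vanishes because \<open>D G (X i)\<close> is horizontal.\<close>
    have "D (D G (X i)) G p = g p (D G (X i) p) (Z p) *\<^sub>R D Z G p + (\<Sum>k\<in>N. a i k *\<^sub>R D (X k) G p)"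
      unfolding conn_tensorial[OF D_linear open_U p subset_refl hor_vf[OF h] vf_G] a_def
      by (rule sum_E)
    then have "D (D G (X i)) G p = (\<Sum>k\<in>N. a i k *\<^sub>R D (X k) G p)"
      using g_Z[OF t] z by simp
    then have "g p (D (D G (X i)) G p) (X i p) = (\<Sum>k\<in>N. a i k * H k i)"
      unfolding H_def
      using g_sum_left[OF X_T[OF p i] vf_T[OF vf_D[OF X_smooth vf_G] p], of N "\<lambda>k. k"] by simp
    moreover have "g p (D (X i) G p) (D G (X i) p) = (\<Sum>k\<in>N. a i k * H i k)"
      unfolding hor_g[OF p t z vf_T[OF vf_D[OF X_smooth[OF i] vf_G] p]] a_def H_def
      by (simp only: mult.commute)
    ultimately show ?thesis by (simp add: sum.distrib)
  qed
  then have "(\<Sum>i\<in>N. g p (D (D G (X i)) G p) (X i p) + g p (D (X i) G p) (D G (X i) p))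
     = (\<Sum>i\<in>N. \<Sum>k\<in>N. a i k * H k i) + (\<Sum>i\<in>N. \<Sum>k\<in>N. a i k * H i k)"
    by (simp add: sum.distrib)
  \<comment> \<open>Renaming the indices costs the sign of the skew matrix \<open>a\<close>, so the
    two sums are opposite.\<close>
  also have "(\<Sum>i\<in>N. \<Sum>k\<in>N. a i k * H k i) = (\<Sum>k\<in>N. \<Sum>i\<in>N. a i k * H k i)"
    by (rule sum.swap)
  also have "\<dots> = - (\<Sum>i\<in>N. \<Sum>k\<in>N. a i k * H i k)"
    unfolding sum_negf[symmetric] using a by (intro sum.cong refl) (metis mult_minus_left)
  finally show ?thesis by simp
qed

text \<open>Symmetric and skew matrices are orthogonal, so the cross term of the splitting vanishes
  in the sum. The skew part contributes (Z f)^2 / 4 times the 2n of \<open>sum_b_sq\<close>.\<close>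

lemma hessian_norm:
  assumes p: "p \<in> U"
  shows "(\<Sum>i\<in>N. g p (D (X i) G p) (D (X i) G p)) = hessian_norm_sq n D X f p + real n / 2 * (Z p f)\<^sup>2"
proof -
  define H where "H i k = g p (D (X i) G p) (X k p)" for i k
  define \<beta> where "\<beta> i k = b p (X i p) (X k p)" for i k
  define S where "S i k = sym_hessian D f (X i) (X k) p" for i k
  have \<beta>: "\<beta> i k = - \<beta> k i" if "i \<in> N" "k \<in> N" for i k
    unfolding \<beta>_def by (rule b_antisym[OF hor_X[OF that(1)] hor_X[OF that(2)] p])
  have S: "S i k = (H i k + H k i) / 2" if "i \<in> N" "k \<in> N" for i k
    unfolding S_def H_def sym_hessian_def hessian[OF X_smooth[OF that(1)] hor_X[OF that(2)] p]
      hessian[OF X_smooth[OF that(2)] hor_X[OF that(1)] p] by simp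
  have H: "H i k = H k i - \<beta> i k * Z p f" if "i \<in> N" "k \<in> N" for i k
    unfolding H_def \<beta>_def by (rule hessian_commute[OF hor_X[OF that(1)] hor_X[OF that(2)] p])
  have HS: "(H i k)\<^sup>2 = (S i k)\<^sup>2 - Z p f * (S i k * \<beta> i k) + (Z p f)\<^sup>2 / 4 * (\<beta> i k)\<^sup>2" if "i \<in> N" "k \<in> N" for i k
  proof -
    have e: "H i k = S i k - Z p f * \<beta> i k / 2"
      using S[OF that] H[OF that] by (simp add: field_simps)
    show ?thesis unfolding e by (simp add: power2_eq_square field_simps)
  qed
  have "(\<Sum>i\<in>N. \<Sum>k\<in>N. S i k * \<beta> i k) = (\<Sum>k\<in>N. \<Sum>i\<in>N. S i k * \<beta> i k)"
    by (rule sum.swap)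
  also have "\<dots> = - (\<Sum>i\<in>N. \<Sum>k\<in>N. S i k * \<beta> i k)"
    unfolding sum_negf[symmetric]
  proof (intro sum.cong refl)
    fix i k assume ik: "i \<in> N" "k \<in> N"
    have "S k i = S i k" using S[OF ik] S[OF ik(2,1)] by simp
    then show "S k i * \<beta> k i = - (S i k * \<beta> i k)" using \<beta>[OF ik] by simp
  qed
  finally have SB: "(\<Sum>i\<in>N. \<Sum>k\<in>N. S i k * \<beta> i k) = 0" by simp
  have "(\<Sum>i\<in>N. g p (D (X i) G p) (D (X i) G p)) = (\<Sum>i\<in>N. \<Sum>k\<in>N. (H i k)\<^sup>2)"
  proof (intro sum.cong refl)
    fix i assume i: "i \<in> N"
    note h = hor_D[OF X_smooth[OF i] hor_G]
    show "g p (D (X i) G p) (D (X i) G p) = (\<Sum>k\<in>N. (H i k)\<^sup>2)"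
      unfolding H_def power2_eq_square by (intro hor_g p vf_T hor_vf[OF h] hor_theta[OF h])
  qed
  also have "\<dots> = (\<Sum>i\<in>N. \<Sum>k\<in>N. (S i k)\<^sup>2 - Z p f * (S i k * \<beta> i k) + (Z p f)\<^sup>2 / 4 * (\<beta> i k)\<^sup>2)"
    by (intro sum.cong refl HS)
  also have "\<dots> = (\<Sum>i\<in>N. \<Sum>k\<in>N. (S i k)\<^sup>2) - Z p f * (\<Sum>i\<in>N. \<Sum>k\<in>N. S i k * \<beta> i k)
      + (Z p f)\<^sup>2 / 4 * (\<Sum>i\<in>N. \<Sum>k\<in>N. (\<beta> i k)\<^sup>2)"
    by (simp only: sum.distrib sum_subtractf sum_distrib_left)
  also have "(\<Sum>i\<in>N. \<Sum>k\<in>N. (\<beta> i k)\<^sup>2) = 2 * real n"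
    unfolding \<beta>_def by (rule sum_b_sq[OF p])
  finally show ?thesis
    unfolding SB by (simp add: hessian_norm_sq_def S_def)
qed

section \<open>Contraction of the torsion terms with \<open>G\<close>\<close>

lemma b_G:
  assumes "p \<in> U" "u \<in> T p"
  shows "b p u (G p) = (\<Sum>k\<in>N. X k p f * b p u (X k p))"
  unfolding horizontal_gradient_frame[OF assms(1)] by (rule b_sum_right[OF assms(2) X_T[OF assms(1)]])

text \<open>Moving the coefficients \<open>X k f\<close> of \<open>G\<close> inside the covariant
  derivative produces their derivatives along \<open>X i\<close> twice, in the derivative of
  \<open>b\<close> and in \<open>D (X i) G\<close>, with opposite signs.\<close>

lemma cov_torsion_G:
  assumes p: "p \<in> U" and i: "i \<in> N"
  shows "(\<Sum>k\<in>N. cov_torsion \<A> D (X i) (X i) (X k) p f * X k p f)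
    = Z p f * (X i p (\<lambda>q. b q (X i q) (G q)) - b p (D (X i) (X i) p) (G p) - b p (X i p) (D (X i) G p))"
proof -
  note s = X_smooth[OF i] and iT = X_T[OF p i]
  have sf: "sm (\<lambda>q. X k q f)" if "k \<in> N" for k by (rule sm_vf[OF X_smooth[OF that] sm_f])
  have sb: "sm (\<lambda>q. b q (X i q) (X k q))" if "k \<in> N" for k by (rule sm_b[OF s X_smooth[OF that]])
  have "X i p (\<lambda>q. b q (X i q) (G q)) = X i p (\<lambda>q. \<Sum>k\<in>N. X k q f * b q (X i q) (X k q))"
    by (rule vfield_cong[OF s p sm_b[OF s vf_G]]) (rule b_G[OF _ X_T[OF _ i]])
  also have "\<dots> = (\<Sum>k\<in>N. X i p (\<lambda>q. X k q f * b q (X i q) (X k q)))"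
    by (rule tv_sum[OF iT near[OF p smooth_fun_mult[OF atlas open_U sf sb]] atlas])
  also have "\<dots> = (\<Sum>k\<in>N. X i p (\<lambda>q. X k q f) * b p (X i p) (X k p) + X k p f * X i p (\<lambda>q. b q (X i q) (X k q)))"
    by (intro sum.cong refl tv_mult[OF iT] near[OF p] sf sb)
  finally have 1: "X i p (\<lambda>q. b q (X i q) (G q)) = \<dots>" .
  have 2: "b p (D (X i) (X i) p) (G p) = (\<Sum>k\<in>N. X k p f * b p (D (X i) (X i) p) (X k p))"
    by (rule b_G[OF p vf_T[OF vf_D[OF s s] p]])
  have DT: "D (X i) (X k) p \<in> T p" if "k \<in> N" for k by (rule vf_T[OF vf_D[OF s X_smooth[OF that]] p])
  have sG: "vf (\<lambda>q. \<Sum>k\<in>N. X k q f *\<^sub>R X k q)"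
    by (intro smooth_vfield_sum smooth_vfield_scale atlas X_smooth sf)
  have "D (X i) G p = D (X i) (\<lambda>q. \<Sum>k\<in>N. X k q f *\<^sub>R X k q) p"
    by (rule conn_cong[OF D_linear open_U s sG p]) (simp_all add: horizontal_gradient_frame)
  also have "\<dots> = (\<Sum>k\<in>N. X k p f *\<^sub>R D (X i) (X k) p + X i p (\<lambda>q. X k q f) *\<^sub>R X k p)"
    by (rule conn_sum_right[OF D_linear open_U p atlas X_smooth s sf])
  finally have "D (X i) G p = (\<Sum>k\<in>N. X k p f *\<^sub>R D (X i) (X k) p) + (\<Sum>k\<in>N. X i p (\<lambda>q. X k q f) *\<^sub>R X k p)"
    unfolding sum.distrib .
  moreover have "(\<Sum>k\<in>N. X k p f *\<^sub>R D (X i) (X k) p) \<in> T p" "(\<Sum>k\<in>N. X i p (\<lambda>q. X k q f) *\<^sub>R X k p) \<in> T p"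
    by (intro tangent_intros(3,4) DT X_T[OF p]; assumption)+
  ultimately have "b p (X i p) (D (X i) G p) = b p (X i p) (\<Sum>k\<in>N. X k p f *\<^sub>R D (X i) (X k) p)
      + b p (X i p) (\<Sum>k\<in>N. X i p (\<lambda>q. X k q f) *\<^sub>R X k p)"
    using b_add_right[OF iT] by simp
  moreover have "b p (X i p) (\<Sum>k\<in>N. X k p f *\<^sub>R D (X i) (X k) p) = (\<Sum>k\<in>N. X k p f * b p (X i p) (D (X i) (X k) p))"
    by (rule b_sum_right[OF iT DT])
  moreover have "b p (X i p) (\<Sum>k\<in>N. X i p (\<lambda>q. X k q f) *\<^sub>R X k p) = (\<Sum>k\<in>N. X i p (\<lambda>q. X k q f) * b p (X i p) (X k p))"
    by (rule b_sum_right[OF iT X_T[OF p]])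
  ultimately have 3: "b p (X i p) (D (X i) G p) = (\<Sum>k\<in>N. X k p f * b p (X i p) (D (X i) (X k) p))
      + (\<Sum>k\<in>N. X i p (\<lambda>q. X k q f) * b p (X i p) (X k p))"
    by simp
  have "(\<Sum>k\<in>N. cov_torsion \<A> D (X i) (X i) (X k) p f * X k p f)
     = (\<Sum>k\<in>N. Z p f * (X k p f * X i p (\<lambda>q. b q (X i q) (X k q)) - X k p f * b p (D (X i) (X i) p) (X k p)
        - X k p f * b p (X i p) (D (X i) (X k) p)))"
    by (intro sum.cong refl)
       (simp add: cov_torsion_hor[OF s hor_X[OF i] hor_X p] scaleR_fun_def algebra_simps)
  then show ?thesis
    unfolding 1 2 3 sum_distrib_left[symmetric] sum_subtractf sum.distrib by simp
qed

text \<open>The inner torsion is a multiple of \<open>Z\<close>, so the outer one is a multiple of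
  T(Z, X i); the weights \<open>X k f\<close> then sum the \<open>X k\<close> to
  \<open>G\<close>.\<close>

lemma torsion_torsion_G:
  assumes p: "p \<in> U" and i: "i \<in> N"
  shows "(\<Sum>k\<in>N. torsion \<A> D (X i) (torsion \<A> D (X i) (X k)) p f * X k p f)
    = - b p (X i p) (G p) * torsion \<A> D Z (X i) p f"
proof -
  have "torsion \<A> D (X i) (torsion \<A> D (X i) (X k)) p f = - b p (X i p) (X k p) * torsion \<A> D Z (X i) p f"
    if k: "k \<in> N" for k
  proof -
    have "torsion \<A> D (X i) (torsion \<A> D (X i) (X k)) p = - b p (X i p) (X k p) *\<^sub>R torsion \<A> D Z (X i) p"
      by (rule torsion_scale_Z[where c = "\<lambda>q. b q (X i q) (X k q)", OF X_smooth[OF i] p])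
         (rule sm_b[OF X_smooth[OF i] X_smooth[OF k]], rule torsion_hor[OF hor_X[OF i] hor_X[OF k]])
    then show ?thesis by (simp add: scaleR_fun_def)
  qed
  then show ?thesis
    unfolding b_G[OF p X_T[OF p i]]
    by (simp add: sum_negf sum_distrib_left sum_distrib_right mult.commute mult.left_commute)
qed

text \<open>\<open>?A\<close> is what remains of \<Gamma>2 minus the Ricci term once the squares of
  \<open>D (X i) G\<close> are set aside; \<open>?B\<close> rewrites it with the torsion terms in
  the shape of \<open>R_form\<close>. Stated with \<open>b\<close> and \<open>G\<close>, it does not
  refer to structure coefficients.\<close>

lemma horizontal_bochner:
  assumes p: "p \<in> U"
  shows "Gam2 L f p = hessian_norm_sq n D X f p + R_form \<A> n \<theta> Z g D X f p
    - 2 * (\<Sum>i\<in>N. b p (X i p) (G p) * X i p (\<lambda>q. Z q f))"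
proof -
  let ?A = "\<lambda>i. g p (D (X i) (D (X i) G) p) (G p) - g p (D (D (X i) (X i)) G p) (G p)
      - g p (D (X i) (D G G) p) (X i p) + g p (D (lie_bracket \<A> (X i) G) G p) (X i p)
      - g p (D (X i) G p) (D G (X i) p)"
  let ?B = "\<lambda>i. - (g p (D (D G (X i)) G p) (X i p) + g p (D (X i) G p) (D G (X i) p))
      - 2 * (b p (X i p) (G p) * X i p (\<lambda>q. Z q f))
      - (\<Sum>k\<in>N. cov_torsion \<A> D (X i) (X i) (X k) p f * X k p f
          + torsion \<A> D (X i) (torsion \<A> D (X i) (X k)) p f * X k p f)"
  have "Gam2 L f p - ricci \<A> D G G p = (\<Sum>i\<in>N. g p (D (X i) G p) (D (X i) G p)) + (\<Sum>i\<in>N. ?A i)"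
    unfolding Gam2_eq[OF p] ricci_G[OF p] by (simp add: sum.distrib sum_subtractf)
  also have "(\<Sum>i\<in>N. ?A i) = (\<Sum>i\<in>N. ?B i)"
  proof (intro sum.cong refl)
    fix i assume i: "i \<in> N"
    show "?A i = ?B i"
      unfolding commutation_term[OF p i] sum.distrib cov_torsion_G[OF p i] torsion_torsion_G[OF p i]
      by (simp add: algebra_simps)
  qed
  also have "\<dots> = - (\<Sum>i\<in>N. g p (D (D G (X i)) G p) (X i p) + g p (D (X i) G p) (D G (X i) p))
      - 2 * (\<Sum>i\<in>N. b p (X i p) (G p) * X i p (\<lambda>q. Z q f))
      - (\<Sum>i\<in>N. \<Sum>k\<in>N. cov_torsion \<A> D (X i) (X i) (X k) p f * X k p f
          + torsion \<A> D (X i) (torsion \<A> D (X i) (X k)) p f * X k p f)"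
    by (simp only: sum_subtractf sum_negf sum_distrib_left)
  finally show ?thesis
    unfolding rotation_terms_cancel[OF p] hessian_norm[OF p] R_form_def by simp
qed

end

theorem theorem3p3:
  fixes \<A> :: "('m::{t2_space, second_countable_topology}, 'e::euclidean_space) atlas"
    and n :: nat
    and \<theta> :: "'m \<Rightarrow> 'm tvec \<Rightarrow> real"
    and Z :: "'m vfield"
    and g :: "'m \<Rightarrow> 'm tvec \<Rightarrow> 'm tvec \<Rightarrow> real"
    and J :: "'m \<Rightarrow> 'm tvec \<Rightarrow> 'm tvec"
    and LC D :: "'m vfield \<Rightarrow> 'm vfield \<Rightarrow> 'm vfield"
    and f :: "'m \<Rightarrow> real"
    and U :: "'m set"
    and X :: "nat \<Rightarrow> 'm vfield"
    and w :: "nat \<Rightarrow> nat \<Rightarrow> nat \<Rightarrow> 'm \<Rightarrow> real"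
    and \<gamma> \<delta> :: "nat \<Rightarrow> nat \<Rightarrow> 'm \<Rightarrow> real"
  assumes "contact_riemannian \<A> n \<theta> Z g J"
    and "riem_complete \<A> g"
    and "levi_civita \<A> g LC"
    and "tanno_connection \<A> \<theta> Z g D"
    and "smooth_fun \<A> UNIV f"
    and "horizontal_frame \<A> n \<theta> g U X"
    and "\<And>i j p. i \<in> {1..2 * n} \<Longrightarrow> j \<in> {1..2 * n} \<Longrightarrow> p \<in> U \<Longrightarrow>
           lie_bracket \<A> (X i) (X j) p = (\<Sum>k=1..2 * n. w i j k p *\<^sub>R X k p) + \<gamma> i j p *\<^sub>R Z p"
    and "\<And>i p. i \<in> {1..2 * n} \<Longrightarrow> p \<in> U \<Longrightarrow>
           lie_bracket \<A> (X i) Z p = (\<Sum>j=1..2 * n. \<delta> i j p *\<^sub>R X j p)"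
    and "\<And>i p. i \<in> {1..2 * n} \<Longrightarrow> p \<in> U \<Longrightarrow> \<delta> i i p = 0"
  shows "\<forall>p\<in>U. Gam2 (sub_laplacian \<A> Z g LC) f p =
           hessian_norm_sq n D X f p + R_form \<A> n \<theta> Z g D X f p
           - 2 * (\<Sum>i=1..2 * n. \<Sum>j=1..2 * n.
                    \<gamma> i j p * X j p (\<lambda>q. Z q f) * X i p f)"
proof
  fix p assume p: "p \<in> U"
  interpret contact_frame \<A> n \<theta> Z g J D U X
    using assms by unfold_locales auto
  have d: "g p (X i p) (lie_bracket \<A> (X i) Z p) = 0" if p: "p \<in> U" and i: "i \<in> N" for p i
  proof -
    have "g p (X i p) (lie_bracket \<A> (X i) Z p) = (\<Sum>j\<in>N. \<delta> i j p * g p (X i p) (X j p))"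
      unfolding assms(8)[OF i p] by (rule g_sum_X(1)[OF p X_T[OF p i]])
    also have "\<dots> = 0"
      by (rule sum.neutral) (use X_ortho[OF p i] assms(9)[OF i p] in auto)
    finally show ?thesis .
  qed
  interpret contact_frame_fun \<A> n \<theta> Z g J D U X f LC
  proof unfold_locales
    show "smooth_fun \<A> U f" using smooth_fun_subset[OF subset_UNIV assms(5)] .
    show "(\<Sum>i\<in>N. g p (X i p) (lie_bracket \<A> (X i) Z p)) = 0" if "p \<in> U" for p
      using d[OF that] by (intro sum.neutral) auto
  qed (fact assms(3))
  \<comment> \<open>Applying \<open>\<theta>\<close> to the bracket isolates
    \<open>\<gamma> i j\<close>, which is -d\<theta>(X i, X j); skewness turns the sign into the
    reversed order of arguments.\<close>
  have \<gamma>: "\<gamma> i j p = b p (X j p) (X i p)" if ij: "i \<in> N" "j \<in> N" for i j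
  proof -
    have S: "(\<Sum>k\<in>N. w i j k p *\<^sub>R X k p) \<in> T p"
      using X_T[OF p] by (intro tangent_intros)
    have "\<theta> p (\<Sum>k\<in>N. w i j k p *\<^sub>R X k p) = (\<Sum>k\<in>N. w i j k p * \<theta> p (X k p))"
      by (rule theta_sum[OF X_T[OF p]])
    also have "\<dots> = 0"
      by (rule sum.neutral) (simp add: theta_X[OF p])
    finally have "\<theta> p (lie_bracket \<A> (X i) (X j) p) = \<gamma> i j p"
      unfolding assms(7)[OF ij p]
      using S Z_T[OF p] by (simp add: theta_add theta_scale theta_Z tangent_intros)
    then show ?thesis
      using b_hor[OF hor_X[OF ij(1)] hor_X[OF ij(2)] p] b_antisym[OF hor_X[OF ij(1)] hor_X[OF ij(2)] p] by simp
  qed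
  \<comment> \<open>The frame index of \<open>horizontal_bochner\<close> becomes \<open>j\<close>
    here, and \<open>i\<close> comes from expanding \<open>G\<close>, so that
    \<open>\<gamma> i j\<close> appears with its indices in the required order.\<close>
  have "(\<Sum>j\<in>N. b p (X j p) (G p) * X j p (\<lambda>q. Z q f))
     = (\<Sum>j\<in>N. \<Sum>i\<in>N. \<gamma> i j p * X j p (\<lambda>q. Z q f) * X i p f)"
  proof (intro sum.cong refl)
    fix j assume j: "j \<in> N"
    have "b p (X j p) (G p) = (\<Sum>i\<in>N. X i p f * \<gamma> i j p)"
      unfolding b_G[OF p X_T[OF p j]] using \<gamma>[OF _ j] by (intro sum.cong refl) auto
    then show "b p (X j p) (G p) * X j p (\<lambda>q. Z q f) = (\<Sum>i\<in>N. \<gamma> i j p * X j p (\<lambda>q. Z q f) * X i p f)"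
      by (simp add: sum_distrib_left mult.commute mult.left_commute)
  qed
  also have "\<dots> = (\<Sum>i\<in>N. \<Sum>j\<in>N. \<gamma> i j p * X j p (\<lambda>q. Z q f) * X i p f)"
    by (rule sum.swap)
  finally show "Gam2 (sub_laplacian \<A> Z g LC) f p =
           hessian_norm_sq n D X f p + R_form \<A> n \<theta> Z g D X f p
           - 2 * (\<Sum>i=1..2 * n. \<Sum>j=1..2 * n. \<gamma> i j p * X j p (\<lambda>q. Z q f) * X i p f)"
    unfolding horizontal_bochner[OF p] by simp
qed

end
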